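(* Let $\alpha$ be a decomposable $E_0$-semigroup over $P$ and let $\mathscr{D}$ denote the set of left coherent sections of decomposable vectors of unit norm. Let $e=(e_x)_{x\in P}\in\mathscr{D}$ be given. Then there exists a unique continuous function $L^e:\Delta^{(2)}\to\mathbb{C}$ which vanishes at the origin and satisfies, for $x\in\Omega$ and $u,v\in D(x)$, $$e^{L^e(x,\dot u,\dot v)}=\frac{\langle u|v\rangle}{\langle u|e_x\rangle\langle e_x|v\rangle}.$$ Suppose $f=(f_x)_{x\in P}$ is another element of $\mathscr{D}$, and denote the corresponding continuous function on $\Delta^{(2)}$ by $L^f$. Then there exists a continuous function $\phi:\Delta\to\mathbb{C}$ that vanishes at the origin such that $$L^f(x,\dot u,\dot v)=L^e(x,\dot u,\dot v)+\phi(x,\dot u)+\overline{\phi(x,\dot v)}$$ for $x\in\Omega$ and $u,v\in D(x)$.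
   Context: $P\subset\mathbb{R}^d$ is a closed convex cone with $P-P=\mathbb{R}^d$ and $P\cap-P=\{0\}$; $\Omega$ is its interior; $x\le y$ means $y-x\in P$. Inner products are linear in the first variable. An $E_0$-semigroup (over $P$) on $B(\mathcal{H})$, $\mathcal{H}$ an infinite-dimensional separable Hilbert space, is a family $\alpha=\{\alpha_x\}_{x\in P}$ of unital normal $*$-endomorphisms of $B(\mathcal{H})$ with $\alpha_x\circ\alpha_y=\alpha_{x+y}$ and $x\mapsto\langle\alpha_x(A)\xi|\eta\rangle$ continuous on $P$ for all $A,\xi,\eta$. Its product system is $E(x)=\{T\in B(\mathcal{H}):\alpha_x(A)T=TA\ \forall A\in B(\mathcal{H})\}$, $x\in P$, a separable Hilbert space with $\langle S|T\rangle1=T^*S$, with multiplication $E(x)\times E(y)\to E(x+y)$ given by composition. $u\in E(x)$ is decomposable if $u\neq0$ and for every $y\in P$ with $y\le x$ there are $v\in E(y)$, $w\in E(x-y)$ with $u=vw$; $D(x)$ is the set of decomposable vectors in $E(x)$. $\alpha$ is decomposable if $D(x)D(y)\subset D(x+y)$ for all $x,y\in P$ and $D(x)$ is total in $E(x)$ for every $x\in P$. A section $(u_x)_{x\in P}$ with $u_x\in D(x)$ is left coherent if for all $x,y\in P$ with $y\le x$ there is a (necessarily unique) $u(y,x)\in D(x-y)$ with $u_x=u_yu(y,x)$. For $x\in\Omega$, $\Delta(x)$ is the set of equivalence classes $\dot u$ of $u\in D(x)$ under identification of nonzero scalar multiples; $\Delta=\{(x,\dot u):x\in\Omega,u\in D(x)\}$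 and $\Delta^{(2)}=\{(x,\dot u,\dot v):x\in\Omega,\ u,v\in D(x)\}$. A function $\phi:\Delta\to\mathbb{C}$ is called continuous if for every left coherent section $(u_x)_{x\in P}$ of decomposable vectors the map $\Omega\ni x\mapsto\phi(x,\dot u_x)$ is continuous; it vanishes at the origin if $\lim_{x\to0}\phi(x,\dot u_x)=0$ for every left coherent section. A function $L$ on $\Delta^{(2)}$ is continuous (resp. vanishes at the origin) if for every pair of left coherent sections $(u_x),(v_x)$ of decomposable vectors, $\Omega\ni x\mapsto L(x,\dot u_x,\dot v_x)$ is continuous (resp. tends to $0$ as $x\to0$). *)

theory Defs
  imports "HOL-Analysis.Analysis"
begin

class complex_vector = real_vector +
  fixes scaleC :: "complex \<Rightarrow> 'a \<Rightarrow> 'a" (infixr "*\<^sub>C" 75)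
  assumes scaleC_add_right: "c *\<^sub>C (x + y) = c *\<^sub>C x + c *\<^sub>C y"
    and scaleC_add_left: "(c + d) *\<^sub>C x = c *\<^sub>C x + d *\<^sub>C x"
    and scaleC_scaleC: "c *\<^sub>C d *\<^sub>C x = (c * d) *\<^sub>C x"
    and scaleC_one: "1 *\<^sub>C x = x"
    and scaleC_of_real: "complex_of_real r *\<^sub>C x = r *\<^sub>R x"

global_interpretation complex_vector: vector_space "scaleC :: complex \<Rightarrow> 'a \<Rightarrow> 'a::complex_vector"
  defines cspan = complex_vector.span
  by unfold_locales (simp_all add: scaleC_add_right scaleC_add_left scaleC_scaleC scaleC_one)

class complex_normed_vector = complex_vector + real_normed_vector +
  assumes norm_scaleC: "norm (c *\<^sub>C x) = cmod c * norm x"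

text \<open>The inner product \<^term>\<open>cinner\<close> is linear in the first variable. Norm and topology are those
  of the underlying real Hilbert space, whose inner product is its real part.\<close>

class complex_hilbert = complex_vector + real_inner + complete_space +
  fixes cinner :: "'a \<Rightarrow> 'a \<Rightarrow> complex"
  assumes cinner_commute: "cinner x y = cnj (cinner y x)"
    and cinner_add_left: "cinner (x + y) z = cinner x z + cinner y z"
    and cinner_scaleC_left: "cinner (c *\<^sub>C x) y = c * cinner x y"
    and Re_cinner: "Re (cinner x y) = inner x y"

instance complex_hilbert \<subseteq> complex_normed_vector
proof
  fix c :: complex and x :: 'a
  have im: "Im (cinner x x) = 0"
    using cinner_commute[of x x] by (simp add: complex_eq_iff)
  have "cinner (c *\<^sub>C x) (c *\<^sub>C x) = c * cinner x (c *\<^sub>C x)"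
    by (rule cinner_scaleC_left)
  also have "cinner x (c *\<^sub>C x) = cnj (c * cinner x x)"
    using cinner_commute[of x "c *\<^sub>C x"] by (simp add: cinner_scaleC_left)
  finally have "cinner (c *\<^sub>C x) (c *\<^sub>C x) = of_real ((cmod c)\<^sup>2) * cnj (cinner x x)"
    by (simp only: complex_cnj_mult mult.assoc[symmetric] complex_norm_square)
  then have "inner (c *\<^sub>C x) (c *\<^sub>C x) = (cmod c)\<^sup>2 * inner x x"
    by (simp add: Re_cinner[symmetric] im)
  then show "norm (c *\<^sub>C x) = cmod c * norm x"
    by (simp add: norm_eq_sqrt_inner real_sqrt_mult)
qed

instantiation blinfun :: (real_normed_vector, complex_normed_vector) complex_vector
begin

lift_definition scaleC_blinfun :: "complex \<Rightarrow> ('a \<Rightarrow>\<^sub>L 'b) \<Rightarrow> ('a \<Rightarrow>\<^sub>L 'b)" is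
  "\<lambda>c T x. c *\<^sub>C T x"
proof -
  fix c :: complex and T :: "'a \<Rightarrow> 'b"
  assume "bounded_linear T"
  then interpret bounded_linear T .
  obtain K where K: "\<And>x. norm (T x) \<le> norm x * K"
    using bounded by blast
  have comm: "c *\<^sub>C r *\<^sub>R y = r *\<^sub>R c *\<^sub>C y" for r and y :: 'b
    by (simp add: scaleC_of_real[symmetric] scaleC_scaleC mult.commute)
  show "bounded_linear (\<lambda>x. c *\<^sub>C T x)"
  proof (rule bounded_linear_intro)
    show "norm (c *\<^sub>C T x) \<le> norm x * (cmod c * K)" for x
      using mult_left_mono[OF K[of x], of "cmod c"] by (simp add: norm_scaleC algebra_simps)
  qed (simp_all add: add scaleC_add_right scale comm)
qed

instance
  by standard
    (transfer, simp add: fun_eq_iff scaleC_add_right scaleC_add_left scaleC_scaleC scaleC_one scaleC_of_real)+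

end

text \<open>The type \<^typ>\<open>'h \<Rightarrow>\<^sub>L 'h\<close> contains all bounded real-linear operators; $B(H)$ is the set of the
  complex-linear ones, and everything below is relative to it.\<close>

definition BH :: "('h::complex_hilbert \<Rightarrow>\<^sub>L 'h) set" where
  "BH = {T. \<forall>c x. blinfun_apply T (c *\<^sub>C x) = c *\<^sub>C blinfun_apply T x}"

definition adj :: "('h::complex_hilbert \<Rightarrow>\<^sub>L 'h) \<Rightarrow> ('h \<Rightarrow>\<^sub>L 'h)" where
  "adj T = (THE S. S \<in> BH \<and> (\<forall>x y. cinner (T x) y = cinner x (S y)))"

text \<open>The topology on $B(H)$ induced by the functionals
  $A \mapsto \sum_n \langle A\xi_n | \eta_n\rangle$ with $\sum_n \|\xi_n\|^2 < \infty$ and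
  $\sum_n \|\eta_n\|^2 < \infty$; its underlying set is \<^term>\<open>BH\<close>.
  Normality of a map on $B(H)$ is continuity for this topology.\<close>

definition sigma_weak_topology :: "('h::complex_hilbert \<Rightarrow>\<^sub>L 'h) topology" where
  "sigma_weak_topology = topology_generated_by
     {{A \<in> BH. (\<Sum>n. cinner (A (\<xi> n)) (\<eta> n)) \<in> U} | (\<xi> :: nat \<Rightarrow> 'h) (\<eta> :: nat \<Rightarrow> 'h) U.
        summable (\<lambda>n. (norm (\<xi> n))\<^sup>2) \<and> summable (\<lambda>n. (norm (\<eta> n))\<^sup>2) \<and> open U}"

definition normal_map :: "(('h::complex_hilbert \<Rightarrow>\<^sub>L 'h) \<Rightarrow> ('h \<Rightarrow>\<^sub>L 'h)) \<Rightarrow> bool" where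
  "normal_map \<theta> \<longleftrightarrow> continuous_map sigma_weak_topology sigma_weak_topology \<theta>"

definition unital_star_endomorphism :: "(('h::complex_hilbert \<Rightarrow>\<^sub>L 'h) \<Rightarrow> ('h \<Rightarrow>\<^sub>L 'h)) \<Rightarrow> bool" where
  "unital_star_endomorphism \<theta> \<longleftrightarrow>
     \<theta> \<in> BH \<rightarrow> BH \<and>
     \<theta> id_blinfun = id_blinfun \<and>
     (\<forall>A\<in>BH. \<forall>B\<in>BH. \<theta> (A + B) = \<theta> A + \<theta> B) \<and>
     (\<forall>c. \<forall>A\<in>BH. \<theta> (c *\<^sub>C A) = c *\<^sub>C \<theta> A) \<and>
     (\<forall>A\<in>BH. \<forall>B\<in>BH. \<theta> (A o\<^sub>L B) = \<theta> A o\<^sub>L \<theta> B) \<and>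
     (\<forall>A\<in>BH. \<theta> (adj A) = adj (\<theta> A))"

definition closed_pointed_generating_cone :: "(real^'d) set \<Rightarrow> bool" where
  "closed_pointed_generating_cone P \<longleftrightarrow> closed P \<and> convex_cone P \<and>
     {x - y | x y. x \<in> P \<and> y \<in> P} = UNIV \<and> P \<inter> uminus ` P = {0}"

definition cone_le :: "(real^'d) set \<Rightarrow> real^'d \<Rightarrow> real^'d \<Rightarrow> bool" where
  "cone_le P x y \<longleftrightarrow> y - x \<in> P"

type_synonym ('d, 'h) op_family = "real^'d \<Rightarrow> ('h \<Rightarrow>\<^sub>L 'h) \<Rightarrow> ('h \<Rightarrow>\<^sub>L 'h)"

definition E0_semigroup :: "(real^'d) set \<Rightarrow> ('d, 'h::complex_hilbert) op_family \<Rightarrow> bool" where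
  "E0_semigroup P \<alpha> \<longleftrightarrow>
     (\<forall>x\<in>P. unital_star_endomorphism (\<alpha> x) \<and> normal_map (\<alpha> x)) \<and>
     (\<forall>x\<in>P. \<forall>y\<in>P. \<forall>A\<in>BH. \<alpha> x (\<alpha> y A) = \<alpha> (x + y) A) \<and>
     (\<forall>A\<in>BH. \<forall>\<xi> \<eta>. continuous_on P (\<lambda>x. cinner (\<alpha> x A \<xi>) \<eta>))"

definition product_system :: "('d, 'h::complex_hilbert) op_family \<Rightarrow> real^'d \<Rightarrow> ('h \<Rightarrow>\<^sub>L 'h) set" where
  "product_system \<alpha> x = {T \<in> BH. \<forall>A\<in>BH. \<alpha> x A o\<^sub>L T = T o\<^sub>L A}"

text \<open>The inner product of a fibre of the product system: $\langle S|T\rangle 1 = T^*S$.\<close>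

definition ps_inner :: "('h::complex_hilbert \<Rightarrow>\<^sub>L 'h) \<Rightarrow> ('h \<Rightarrow>\<^sub>L 'h) \<Rightarrow> complex" where
  "ps_inner S T = (THE c. c *\<^sub>C id_blinfun = adj T o\<^sub>L S)"

definition ps_norm :: "('h::complex_hilbert \<Rightarrow>\<^sub>L 'h) \<Rightarrow> real" where
  "ps_norm T = sqrt (Re (ps_inner T T))"

definition ps_total :: "('h::complex_hilbert \<Rightarrow>\<^sub>L 'h) set \<Rightarrow> ('h \<Rightarrow>\<^sub>L 'h) set \<Rightarrow> bool" where
  "ps_total D E \<longleftrightarrow> D \<subseteq> E \<and> (\<forall>T\<in>E. \<forall>\<epsilon>>0. \<exists>S\<in>cspan D. ps_norm (T - S) < \<epsilon>)"

definition decomposables ::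
    "(real^'d) set \<Rightarrow> ('d, 'h::complex_hilbert) op_family \<Rightarrow> real^'d \<Rightarrow> ('h \<Rightarrow>\<^sub>L 'h) set" where
  "decomposables P \<alpha> x = {u \<in> product_system \<alpha> x. u \<noteq> 0 \<and>
     (\<forall>y\<in>P. cone_le P y x \<longrightarrow>
        (\<exists>v\<in>product_system \<alpha> y. \<exists>w\<in>product_system \<alpha> (x - y). u = v o\<^sub>L w))}"

definition decomposable_E0_semigroup ::
    "(real^'d) set \<Rightarrow> ('d, 'h::complex_hilbert) op_family \<Rightarrow> bool" where
  "decomposable_E0_semigroup P \<alpha> \<longleftrightarrow> E0_semigroup P \<alpha> \<and>
     (\<forall>x\<in>P. \<forall>y\<in>P. \<forall>u\<in>decomposables P \<alpha> x. \<forall>v\<in>decomposables P \<alpha> y.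
        u o\<^sub>L v \<in> decomposables P \<alpha> (x + y)) \<and>
     (\<forall>x\<in>P. ps_total (decomposables P \<alpha> x) (product_system \<alpha> x))"

definition left_coherent ::
    "(real^'d) set \<Rightarrow> ('d, 'h::complex_hilbert) op_family \<Rightarrow> (real^'d \<Rightarrow> ('h \<Rightarrow>\<^sub>L 'h)) \<Rightarrow> bool" where
  "left_coherent P \<alpha> u \<longleftrightarrow>
     (\<forall>x\<in>P. u x \<in> decomposables P \<alpha> x) \<and>
     (\<forall>x\<in>P. \<forall>y\<in>P. cone_le P y x \<longrightarrow> (\<exists>w\<in>decomposables P \<alpha> (x - y). u x = u y o\<^sub>L w))"

definition unit_left_coherent ::
    "(real^'d) set \<Rightarrow> ('d, 'h::complex_hilbert) op_family \<Rightarrow> (real^'d \<Rightarrow> ('h \<Rightarrow>\<^sub>L 'h)) \<Rightarrow> bool" where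
  "unit_left_coherent P \<alpha> u \<longleftrightarrow> left_coherent P \<alpha> u \<and> (\<forall>x\<in>P. ps_norm (u x) = 1)"

definition ray :: "('h::complex_hilbert \<Rightarrow>\<^sub>L 'h) \<Rightarrow> ('h \<Rightarrow>\<^sub>L 'h) set" where
  "ray u = {c *\<^sub>C u | c. c \<noteq> 0}"

definition Delta ::
    "(real^'d) set \<Rightarrow> ('d, 'h::complex_hilbert) op_family \<Rightarrow> ((real^'d) \<times> ('h \<Rightarrow>\<^sub>L 'h) set) set" where
  "Delta P \<alpha> = {(x, ray u) | x u. x \<in> interior P \<and> u \<in> decomposables P \<alpha> x}"

definition Delta2 ::
    "(real^'d) set \<Rightarrow> ('d, 'h::complex_hilbert) op_family \<Rightarrow>
      ((real^'d) \<times> ('h \<Rightarrow>\<^sub>L 'h) set \<times> ('h \<Rightarrow>\<^sub>L 'h) set) set" where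
  "Delta2 P \<alpha> = {(x, ray u, ray v) | x u v.
     x \<in> interior P \<and> u \<in> decomposables P \<alpha> x \<and> v \<in> decomposables P \<alpha> x}"

definition Delta_continuous ::
    "(real^'d) set \<Rightarrow> ('d, 'h::complex_hilbert) op_family \<Rightarrow>
      ((real^'d) \<times> ('h \<Rightarrow>\<^sub>L 'h) set \<Rightarrow> complex) \<Rightarrow> bool" where
  "Delta_continuous P \<alpha> \<phi> \<longleftrightarrow>
     (\<forall>u. left_coherent P \<alpha> u \<longrightarrow> continuous_on (interior P) (\<lambda>x. \<phi> (x, ray (u x))))"

definition Delta_vanishes_at_origin ::
    "(real^'d) set \<Rightarrow> ('d, 'h::complex_hilbert) op_family \<Rightarrow>
      ((real^'d) \<times> ('h \<Rightarrow>\<^sub>L 'h) set \<Rightarrow> complex) \<Rightarrow> bool" where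
  "Delta_vanishes_at_origin P \<alpha> \<phi> \<longleftrightarrow>
     (\<forall>u. left_coherent P \<alpha> u \<longrightarrow> ((\<lambda>x. \<phi> (x, ray (u x))) \<longlongrightarrow> 0) (at 0 within interior P))"

definition Delta2_continuous ::
    "(real^'d) set \<Rightarrow> ('d, 'h::complex_hilbert) op_family \<Rightarrow>
      ((real^'d) \<times> ('h \<Rightarrow>\<^sub>L 'h) set \<times> ('h \<Rightarrow>\<^sub>L 'h) set \<Rightarrow> complex) \<Rightarrow> bool" where
  "Delta2_continuous P \<alpha> L \<longleftrightarrow>
     (\<forall>u v. left_coherent P \<alpha> u \<longrightarrow> left_coherent P \<alpha> v \<longrightarrow>
        continuous_on (interior P) (\<lambda>x. L (x, ray (u x), ray (v x))))"

definition Delta2_vanishes_at_origin ::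
    "(real^'d) set \<Rightarrow> ('d, 'h::complex_hilbert) op_family \<Rightarrow>
      ((real^'d) \<times> ('h \<Rightarrow>\<^sub>L 'h) set \<times> ('h \<Rightarrow>\<^sub>L 'h) set \<Rightarrow> complex) \<Rightarrow> bool" where
  "Delta2_vanishes_at_origin P \<alpha> L \<longleftrightarrow>
     (\<forall>u v. left_coherent P \<alpha> u \<longrightarrow> left_coherent P \<alpha> v \<longrightarrow>
        ((\<lambda>x. L (x, ray (u x), ray (v x))) \<longlongrightarrow> 0) (at 0 within interior P))"

text \<open>The defining properties of $L^e$. As a function on \<^term>\<open>Delta2 P \<alpha>\<close>, \<^term>\<open>L\<close> is taken to be
  \<^term>\<open>undefined\<close> off that set, so that unique existence is meaningful. Since \<^term>\<open>exp\<close> has no zero and division by zero gives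
  zero, the equation includes the claim that all three inner products are nonzero.\<close>

definition is_covariance_log ::
    "(real^'d) set \<Rightarrow> ('d, 'h::complex_hilbert) op_family \<Rightarrow> (real^'d \<Rightarrow> ('h \<Rightarrow>\<^sub>L 'h)) \<Rightarrow>
      ((real^'d) \<times> ('h \<Rightarrow>\<^sub>L 'h) set \<times> ('h \<Rightarrow>\<^sub>L 'h) set \<Rightarrow> complex) \<Rightarrow> bool" where
  "is_covariance_log P \<alpha> e L \<longleftrightarrow>
     L \<in> Delta2 P \<alpha> \<rightarrow>\<^sub>E UNIV \<and>
     Delta2_continuous P \<alpha> L \<and>
     Delta2_vanishes_at_origin P \<alpha> L \<and>
     (\<forall>x\<in>interior P. \<forall>u\<in>decomposables P \<alpha> x. \<forall>v\<in>decomposables P \<alpha> x.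
        exp (L (x, ray u, ray v)) = ps_inner u v / (ps_inner u (e x) * ps_inner (e x) v))"

end

theory Submission
  imports Defs
begin

text \<open>
  The proof rests on one observation (\<open>continuous_up_to_scalars\<close>): left coherence leaves the scalars
  of a section arbitrary, but at each point of the cone continuity of \<open>\<alpha>\<close> forces \<open>y \<mapsto> u\<^sub>y\<zeta>\<close> to be norm
  continuous after multiplication with scalars that do not depend on the vector \<open>\<zeta>\<close>. Every expression in inner products of sections
  that is insensitive to rescaling is therefore continuous on the whole cone, wherever its
  denominator does not vanish. The covariance \<open>\<langle>u\<^sub>x|v\<^sub>x\<rangle> / (\<langle>u\<^sub>x|e\<^sub>x\<rangle>\<langle>e\<^sub>x|v\<^sub>x\<rangle>)\<close> is such an expression,
  because \<open>e\<close> has unit norm.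

  The inner product of two left coherent sections vanishes nowhere (\<open>ps_inner_left_coherent_nonzero\<close>). On the
  segment from \<open>0\<close> to \<open>x\<close> the inner product of two sections is multiplicative, and continuity up to
  scalars shows that the right factors over short intervals of two sections are nearly parallel. So
  the set where it is nonzero is open and closed in the segment, and it contains \<open>0\<close>, because the fibre
  over \<open>0\<close> consists of scalars.

  Along a pair of sections the covariance is thus a continuous map of the convex set \<open>P\<close> into the
  nonzero complex numbers, with value \<open>1\<close> at \<open>0\<close>. It has a unique continuous logarithm vanishing at \<open>0\<close>.
  Left factors are unique up to scalars, so the ray of a section at \<open>x\<close> determines its rays on the
  segment from \<open>0\<close> to \<open>x\<close>, and the value of the logarithm at \<open>x\<close> depends only on the two rays at \<open>x\<close>
  (\<open>section_log_depends_on_rays\<close>). Every decomposable vector over an interior point lies, up to a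
  scalar, on a left coherent section made of left factors of its powers (\<open>left_coherent_through\<close>). This gives
  existence and, as the interior of \<open>P\<close> is connected and accumulates at \<open>0\<close>, uniqueness of \<open>L\<^sup>e\<close>.

  Uniqueness also yields the second part, since it suffices to exponentiate: \<open>L\<^sup>e\<close> is hermitian and
  \<open>L\<^sup>f(u, v) = L\<^sup>e(u, v) - L\<^sup>e(u, f) - L\<^sup>e(f, v) + L\<^sup>e(f, f)\<close>, so that
  \<open>\<phi>(u) = L\<^sup>e(f, f) / 2 - L\<^sup>e(u, f)\<close> has the required properties.
\<close>

section \<open>Complex Hilbert spaces\<close>

lemma cinner_add_right: "cinner x (y + z) = cinner x y + cinner x (z::'h::complex_hilbert)"
  by (metis cinner_add_left cinner_commute complex_cnj_add)

lemma cinner_scaleC_right: "cinner x (c *\<^sub>C y) = cnj c * cinner x (y::'h::complex_hilbert)"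
  by (metis cinner_commute cinner_scaleC_left complex_cnj_mult)

lemma cinner_diff_left: "cinner (x - y) z = cinner x z - cinner y (z::'h::complex_hilbert)"
  by (metis add_diff_cancel_right' cinner_add_left diff_add_cancel)

lemma cinner_diff_right: "cinner x (y - z) = cinner x y - cinner x (z::'h::complex_hilbert)"
  by (metis add_diff_cancel_right' cinner_add_right diff_add_cancel)

lemma cinner_zero_left [simp]: "cinner 0 (x::'h::complex_hilbert) = 0"
  using cinner_diff_left[of 0 0 x] by simp

lemma cinner_self: "cinner x x = complex_of_real ((norm (x::'h::complex_hilbert))\<^sup>2)"
  using cinner_commute[of x x] Re_cinner[of x x]
  by (simp add: complex_eq_iff power2_norm_eq_inner)

lemma cinner_self_eq_0_iff [simp]: "cinner x x = 0 \<longleftrightarrow> (x::'h::complex_hilbert) = 0"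
  by (simp add: cinner_self)

lemma cinner_extensionality:
  assumes "\<And>z. cinner x z = cinner (y::'h::complex_hilbert) z"
  shows "x = y"
proof -
  have "cinner (x - y) (x - y) = 0"
    using assms by (simp add: cinner_diff_left)
  then show ?thesis by simp
qed

lemma cinner_eq_Complex:
  "cinner x y = Complex (inner x y) (inner x (\<i> *\<^sub>C (y::'h::complex_hilbert)))"
  by (simp add: complex_eq_iff Re_cinner[symmetric] cinner_scaleC_right)

lemma cmod_cinner_le: "cmod (cinner x y) \<le> norm x * norm (y::'h::complex_hilbert)"
proof -
  define c where "c = cnj (sgn (cinner x y))"
  have c: "cmod c \<le> 1" by (simp add: c_def norm_sgn)
  have "cmod (cinner x y) = Re (c * cinner x y)"
    by (cases "cinner x y = 0")
      (simp_all add: c_def sgn_div_norm scaleR_conv_of_real complex_norm_square[symmetric]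
        mult.commute[of "cnj _"] power2_eq_square field_simps)
  also have "\<dots> = inner (c *\<^sub>C x) y"
    by (simp add: cinner_scaleC_left Re_cinner[symmetric])
  also have "\<dots> \<le> norm (c *\<^sub>C x) * norm y"
    by (rule norm_cauchy_schwarz)
  also have "\<dots> \<le> norm x * norm y"
    using c by (simp add: norm_scaleC mult_left_le_one_le mult_right_mono)
  finally show ?thesis .
qed

lemma bounded_linear_scaleC: "bounded_linear (\<lambda>x::'a::complex_normed_vector. c *\<^sub>C x)"
proof
  show "c *\<^sub>C r *\<^sub>R x = r *\<^sub>R c *\<^sub>C x" for r and x :: 'a
    by (simp add: scaleC_of_real[symmetric] scaleC_scaleC mult.commute)
  show "\<exists>K. \<forall>x::'a. norm (c *\<^sub>C x) \<le> norm x * K"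
    by (rule exI[of _ "cmod c"]) (simp add: norm_scaleC mult.commute)
qed (rule scaleC_add_right)

lemma tendsto_cinner [tendsto_intros]:
  fixes f g :: "'a \<Rightarrow> 'h::complex_hilbert"
  assumes "(f \<longlongrightarrow> a) F" "(g \<longlongrightarrow> b) F"
  shows "((\<lambda>x. cinner (f x) (g x)) \<longlongrightarrow> cinner a b) F"
  unfolding cinner_eq_Complex
  by (intro tendsto_intros assms bounded_linear.tendsto[OF bounded_linear_scaleC])

text \<open>A minimiser \<open>z\<close> of \<open>\<parallel>x\<parallel>\<^sup>2 - 2 * f x\<close> represents \<open>f\<close>: vanishing of the first variation at \<open>z\<close> in the
  direction \<open>x\<close> is the equation \<open>f x = \<langle>z, x\<rangle>\<close>. By the parallelogram law every minimising sequence is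
  Cauchy, so completeness provides the minimiser.\<close>

lemma riesz_representation:
  fixes f :: "'a::{real_inner, complete_space} \<Rightarrow> real"
  assumes "bounded_linear f"
  shows "\<exists>z. \<forall>x. f x = inner z x"
proof -
  interpret f: bounded_linear f by fact
  obtain K where K: "\<And>x. \<bar>f x\<bar> \<le> norm x * K"
    using f.bounded by auto
  define J where "J x = (norm x)\<^sup>2 - 2 * f x" for x
  have J_ge: "J x \<ge> - K\<^sup>2" for x
  proof -
    have "J x \<ge> (norm x)\<^sup>2 - 2 * (norm x * K)"
      using K[of x] by (simp add: J_def abs_le_iff)
    moreover have "(norm x)\<^sup>2 - 2 * (norm x * K) + K\<^sup>2 = (norm x - K)\<^sup>2"
      by (simp add: power2_diff)
    ultimately show ?thesis
      by (smt (verit) zero_le_power2)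
  qed
  then have bdd: "bdd_below (range J)" by (auto simp: bdd_below_def)
  define m where "m = Inf (range J)"
  have m_le: "m \<le> J x" for x
    unfolding m_def by (rule cInf_lower[OF _ bdd]) simp
  have "\<exists>x. J x < m + 1 / real (Suc n)" for n
    using cInf_lessD[of "range J" "m + 1 / real (Suc n)"] by (auto simp: m_def)
  then obtain X where X: "\<And>n. J (X n) < m + 1 / real (Suc n)" by metis
  have parallelogram: "(norm (x - y))\<^sup>2 = 2 * J x + 2 * J y - 4 * J ((1/2) *\<^sub>R (x + y))" for x y
  proof -
    have "4 * (norm ((1/2) *\<^sub>R (x + y)))\<^sup>2 = (norm (x + y))\<^sup>2"
      by (simp add: power_divide)
    moreover have "(norm (x - y))\<^sup>2 + (norm (x + y))\<^sup>2 = 2 * (norm x)\<^sup>2 + 2 * (norm y)\<^sup>2"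
      unfolding power2_norm_eq_inner
      by (simp add: inner_diff_left inner_diff_right inner_add_left inner_add_right inner_commute)
    ultimately show ?thesis
      unfolding J_def f.scaleR f.add by (simp add: add_divide_distrib)
  qed
  have "Cauchy X"
  proof (rule metric_CauchyI)
    fix \<epsilon> :: real assume "\<epsilon> > 0"
    then obtain N where N: "4 / real (Suc N) < \<epsilon>\<^sup>2"
      using nat_approx_posE[of "\<epsilon>\<^sup>2 / 4"] by (auto simp: field_simps)
    show "\<exists>M. \<forall>k\<ge>M. \<forall>n\<ge>M. dist (X k) (X n) < \<epsilon>"
    proof (intro exI allI impI)
      fix k n assume "N \<le> k" "N \<le> n"
      then have "1 / real (Suc k) \<le> 1 / real (Suc N)" "1 / real (Suc n) \<le> 1 / real (Suc N)"
        by (simp_all add: divide_simps)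
      then have "(norm (X k - X n))\<^sup>2 < 4 / real (Suc N)"
        using X[of k] X[of n] m_le[of "(1/2) *\<^sub>R (X k + X n)"] parallelogram[of "X k" "X n"]
        by simp
      then have "(norm (X k - X n))\<^sup>2 < \<epsilon>\<^sup>2" using N by linarith
      then show "dist (X k) (X n) < \<epsilon>"
        using \<open>\<epsilon> > 0\<close> by (simp add: dist_norm power_less_imp_less_base)
    qed
  qed
  then obtain z where z: "X \<longlonglongrightarrow> z"
    using Cauchy_convergent convergent_def by blast
  have Jz: "J z \<le> m"
  proof (rule LIMSEQ_le)
    show "(\<lambda>n. J (X n)) \<longlonglongrightarrow> J z"
      unfolding J_def by (intro tendsto_intros z f.tendsto)
    show "(\<lambda>n. m + 1 / real (Suc n)) \<longlonglongrightarrow> m"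
      using tendsto_add[OF tendsto_const[of m] LIMSEQ_inverse_real_of_nat]
      by (simp add: inverse_eq_divide)
  qed (use X less_imp_le in blast)
  have "f x = inner z x" for x
  proof -
    define d where "d = inner z x - f x"
    define q where "q = (norm x)\<^sup>2 + 1"
    have q: "q \<ge> 1" by (simp add: q_def)
    have "0 \<le> J (z + t *\<^sub>R x) - J z" for t
      using Jz m_le[of "z + t *\<^sub>R x"] by linarith
    also have "J (z + t *\<^sub>R x) - J z = 2 * t * d + t\<^sup>2 * (norm x)\<^sup>2" for t
      unfolding J_def f.add f.scaleR power2_norm_eq_inner d_def
      by (simp add: inner_add_left inner_add_right inner_commute power2_eq_square algebra_simps)
    finally have nn: "0 \<le> 2 * t * d + t\<^sup>2 * (norm x)\<^sup>2" for t .
    \<comment> \<open>The step \<open>t = - d / q\<close> is optimal for the quadratic \<open>2 * t * d + t\<^sup>2 * q\<close>, where \<open>q\<close> bounds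
      \<open>\<parallel>x\<parallel>\<^sup>2\<close> and is nonzero even for \<open>x = 0\<close>.\<close>
    have "0 \<le> 2 * (- d / q) * d + (d / q)\<^sup>2 * q"
    proof -
      have "(d / q)\<^sup>2 * (norm x)\<^sup>2 \<le> (d / q)\<^sup>2 * q"
        by (intro mult_left_mono) (auto simp: q_def)
      then show ?thesis using nn[of "- d / q"] by simp
    qed
    also have "\<dots> = - (d\<^sup>2 / q)"
      using q by (simp add: field_simps power2_eq_square)
    finally have "d\<^sup>2 / q \<le> 0" by simp
    then have "d = 0"
      using q by (simp add: divide_le_0_iff)
    then show ?thesis by (simp add: d_def)
  qed
  then show ?thesis by blast
qed

section \<open>Adjoints and rank-one operators\<close>

lemma BH_scaleC: "T \<in> BH \<Longrightarrow> T (c *\<^sub>C x) = c *\<^sub>C T x"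
  by (simp add: BH_def)

lemma id_in_BH [simp]: "id_blinfun \<in> BH"
  by (simp add: BH_def)

lemma compose_in_BH: "S \<in> BH \<Longrightarrow> T \<in> BH \<Longrightarrow> S o\<^sub>L T \<in> BH"
  by (simp add: BH_def)

lemma scaleC_blinfun_apply [simp]: "blinfun_apply (c *\<^sub>C T) x = c *\<^sub>C blinfun_apply T x"
  by transfer simp

lemma scaleC_in_BH: "T \<in> BH \<Longrightarrow> c *\<^sub>C T \<in> BH"
  by (simp add: BH_def scaleC_scaleC mult.commute)

lemma diff_in_BH: "S \<in> BH \<Longrightarrow> T \<in> BH \<Longrightarrow> S - T \<in> BH"
  by (simp add: BH_def blinfun.diff_left complex_vector.scale_right_diff_distrib)

lemma scaleC_compose_left: "(c *\<^sub>C S) o\<^sub>L T = c *\<^sub>C (S o\<^sub>L T)"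
  by (rule blinfun_eqI) simp

lemma scaleC_compose_right: "S \<in> BH \<Longrightarrow> S o\<^sub>L (c *\<^sub>C T) = c *\<^sub>C (S o\<^sub>L T)"
  by (rule blinfun_eqI) (simp add: BH_scaleC)

text \<open>The Riesz representation produces an adjoint for the real inner product; for complex-linear
  \<open>T\<close> it is also the adjoint for the complex one.\<close>

lemma adj_exists:
  assumes T: "T \<in> BH"
  shows "\<exists>S\<in>BH. \<forall>x y. cinner (T x) y = cinner x (S y)"
proof -
  have "\<exists>z. \<forall>x. inner (T x) y = inner z x" for y
    by (rule riesz_representation)
      (intro bounded_linear_compose[OF bounded_linear_inner_left blinfun.bounded_linear_right])
  then obtain S where "\<And>x y. inner (T x) y = inner (S y) x" by metis
  then have S: "\<And>x y. inner (T x) y = inner x (S y)" by (metis inner_commute)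
  have eq: "cinner (T x) y = cinner x (S y)" for x y
  proof (rule complex_eqI)
    show "Re (cinner (T x) y) = Re (cinner x (S y))"
      by (simp add: Re_cinner S)
    \<comment> \<open>The imaginary parts are the real parts with \<open>x\<close> rotated by \<open>\<i>\<close>.\<close>
    have "Re (cinner (T (\<i> *\<^sub>C x)) y) = Re (cinner (\<i> *\<^sub>C x) (S y))"
      by (simp only: Re_cinner S)
    then show "Im (cinner (T x) y) = Im (cinner x (S y))"
      by (simp add: BH_scaleC[OF T] cinner_scaleC_left)
  qed
  have bl: "bounded_linear S"
  proof (rule bounded_linear_intro)
    show "S (x + y) = S x + S y" for x y
    proof (rule vector_eq_ldot[THEN iffD1], rule allI)
      show "inner z (S (x + y)) = inner z (S x + S y)" for z
        by (simp add: S[symmetric] inner_add_right)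
    qed
    show "S (r *\<^sub>R x) = r *\<^sub>R S x" for r x
    proof (rule vector_eq_ldot[THEN iffD1], rule allI)
      show "inner z (S (r *\<^sub>R x)) = inner z (r *\<^sub>R S x)" for z
        by (simp add: S[symmetric])
    qed
    show "norm (S x) \<le> norm x * norm T" for x
    proof (cases "S x = 0")
      case False
      have "norm (S x) * norm (S x) = inner (T (S x)) x"
        by (simp add: S power2_norm_eq_inner[symmetric] power2_eq_square[symmetric])
      also have "\<dots> \<le> (norm T * norm (S x)) * norm x"
        using norm_cauchy_schwarz[of "T (S x)" x] norm_blinfun[of T "S x"]
        by (meson mult_right_mono norm_ge_zero order_trans)
      finally show ?thesis using False by (simp add: mult.commute mult.left_commute)
    qed simp
  qed
  have "Blinfun S \<in> BH"
  proof -
    have "S (c *\<^sub>C x) = c *\<^sub>C S x" for c x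
    proof (rule cinner_extensionality)
      fix z
      have "cinner z (S (c *\<^sub>C x)) = cinner z (c *\<^sub>C S x)"
        by (simp add: eq[symmetric] cinner_scaleC_right)
      then show "cinner (S (c *\<^sub>C x)) z = cinner (c *\<^sub>C S x) z"
        by (metis cinner_commute)
    qed
    then show ?thesis by (simp add: BH_def bounded_linear_Blinfun_apply[OF bl])
  qed
  then show ?thesis
    using eq by (intro bexI[of _ "Blinfun S"]) (simp_all add: bounded_linear_Blinfun_apply[OF bl])
qed

lemma adj:
  assumes "T \<in> BH"
  shows adj_in_BH: "adj T \<in> BH"
    and cinner_adj_right: "cinner x (adj T y) = cinner (T x) y"
proof -
  obtain S where S: "S \<in> BH" "\<forall>x y. cinner (T x) y = cinner x (S y)"
    using adj_exists[OF assms] by blast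
  have "adj T \<in> BH \<and> (\<forall>x y. cinner (T x) y = cinner x (adj T y))"
    unfolding adj_def
  proof (rule theI[of _ S])
    fix S' assume S': "S' \<in> BH \<and> (\<forall>x y. cinner (T x) y = cinner x (S' y))"
    show "S' = S"
    proof (rule blinfun_eqI, rule cinner_extensionality)
      fix y z
      show "cinner (S' y) z = cinner (S y) z"
        using S' S by (metis cinner_commute)
    qed
  qed (use S in blast)
  then show "adj T \<in> BH" "cinner x (adj T y) = cinner (T x) y" by simp_all
qed

lemma cinner_adj_left: "T \<in> BH \<Longrightarrow> cinner (adj T x) y = cinner x (T y)"
  by (metis cinner_adj_right cinner_commute)

lift_definition rank_one :: "'h::complex_hilbert \<Rightarrow> 'h \<Rightarrow> 'h \<Rightarrow>\<^sub>L 'h" is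
  "\<lambda>\<xi> \<eta> x. cinner x \<eta> *\<^sub>C \<xi>"
proof (rule bounded_linear_intro)
  fix \<xi> \<eta> x :: 'h
  have "cmod (cinner x \<eta>) * norm \<xi> \<le> norm x * norm \<eta> * norm \<xi>"
    by (intro mult_right_mono cmod_cinner_le) simp
  then show "norm (cinner x \<eta> *\<^sub>C \<xi>) \<le> norm x * (norm \<eta> * norm \<xi>)"
    by (simp add: norm_scaleC mult.assoc)
next
  fix \<xi> \<eta> x :: 'h and r
  show "cinner (r *\<^sub>R x) \<eta> *\<^sub>C \<xi> = r *\<^sub>R cinner x \<eta> *\<^sub>C \<xi>"
    by (simp add: scaleC_of_real[symmetric] cinner_scaleC_left scaleC_scaleC)
qed (simp add: cinner_add_left scaleC_add_left)

declare rank_one.rep_eq [simp]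

lemma rank_one_in_BH [simp]: "rank_one \<xi> \<eta> \<in> BH"
  by (simp add: BH_def cinner_scaleC_left scaleC_scaleC)

lemma commutant_BH:
  fixes C :: "'h::complex_hilbert \<Rightarrow>\<^sub>L 'h"
  assumes comm: "\<And>A. A \<in> BH \<Longrightarrow> A o\<^sub>L C = C o\<^sub>L A" and "(\<zeta>::'h) \<noteq> 0"
  shows "\<exists>c. C = c *\<^sub>C id_blinfun"
proof (rule exI, rule blinfun_eqI)
  fix \<xi> :: 'h
  \<comment> \<open>Commute \<open>C\<close> with the operator sending \<open>\<zeta>\<close> to a multiple of \<open>\<xi>\<close> and evaluate at \<open>\<zeta>\<close>.\<close>
  have "(rank_one \<xi> \<zeta> o\<^sub>L C) \<zeta> = (C o\<^sub>L rank_one \<xi> \<zeta>) \<zeta>"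
    by (simp add: comm)
  then have *: "cinner (C \<zeta>) \<zeta> *\<^sub>C \<xi> = C (complex_of_real ((norm \<zeta>)\<^sup>2) *\<^sub>C \<xi>)"
    by (simp add: cinner_self)
  then have "cinner (C \<zeta>) \<zeta> *\<^sub>C \<xi> = complex_of_real ((norm \<zeta>)\<^sup>2) *\<^sub>C C \<xi>"
    by (simp only: scaleC_of_real blinfun.scaleR_right)
  then have "inverse (complex_of_real ((norm \<zeta>)\<^sup>2)) *\<^sub>C cinner (C \<zeta>) \<zeta> *\<^sub>C \<xi>
      = inverse (complex_of_real ((norm \<zeta>)\<^sup>2)) *\<^sub>C complex_of_real ((norm \<zeta>)\<^sup>2) *\<^sub>C C \<xi>"
    by simp
  then show "C \<xi> = ((inverse (complex_of_real ((norm \<zeta>)\<^sup>2)) * cinner (C \<zeta>) \<zeta>) *\<^sub>C id_blinfun) \<xi>"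
    using assms(2) by (simp add: scaleC_scaleC scaleC_one del: of_real_power)
qed

section \<open>Fibres of the product system\<close>

lemma product_systemD:
  fixes \<alpha> :: "('d::finite, 'h::complex_hilbert) op_family"
  assumes "T \<in> product_system \<alpha> x"
  shows product_system_BH: "T \<in> BH"
    and intertwine: "A \<in> BH \<Longrightarrow> \<alpha> x A (T \<xi>) = T (A \<xi>)"
  using assms unfolding product_system_def by (auto dest!: bspec dest: arg_cong[where f="\<lambda>S. blinfun_apply S \<xi>"])

lemma product_systemI:
  fixes \<alpha> :: "('d::finite, 'h::complex_hilbert) op_family"
  assumes "T \<in> BH" "\<And>A \<xi>. A \<in> BH \<Longrightarrow> \<alpha> x A (T \<xi>) = T (A \<xi>)"
  shows "T \<in> product_system \<alpha> x"
  using assms unfolding product_system_def by (auto intro!: blinfun_eqI)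

text \<open>Nontriviality of the Hilbert space is what makes the scalar in \<open>\<langle>S|T\<rangle> 1 = T\<^sup>*S\<close> unique.\<close>

locale decomposable_semigroup =
  fixes P :: "(real^'d::finite) set"
    and \<alpha> :: "('d, 'h::complex_hilbert) op_family"
  assumes cone: "closed_pointed_generating_cone P"
    and decomposable: "decomposable_E0_semigroup P \<alpha>"
    and nontrivial: "\<exists>\<zeta>::'h. \<zeta> \<noteq> 0"
begin

abbreviation "E \<equiv> product_system \<alpha>"
abbreviation "D \<equiv> decomposables P \<alpha>"

lemma convex_cone_P: "convex_cone P"
  using cone by (simp add: closed_pointed_generating_cone_def)

lemma zero_in_P [simp]: "0 \<in> P"
  and add_in_P: "x \<in> P \<Longrightarrow> y \<in> P \<Longrightarrow> x + y \<in> P"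
  and scaleR_in_P: "x \<in> P \<Longrightarrow> 0 \<le> c \<Longrightarrow> c *\<^sub>R x \<in> P"
  using convex_cone_P by (simp_all add: convex_cone_iff)

lemma convex_P: "convex P"
  using convex_cone_P by (simp add: convex_cone_def)

lemma E0: "E0_semigroup P \<alpha>"
  using decomposable by (simp add: decomposable_E0_semigroup_def)

lemma
  assumes "x \<in> P" "A \<in> BH"
  shows \<alpha>_BH: "\<alpha> x A \<in> BH"
    and \<alpha>_adj: "\<alpha> x (adj A) = adj (\<alpha> x A)"
    and \<alpha>_compose: "B \<in> BH \<Longrightarrow> \<alpha> x (A o\<^sub>L B) = \<alpha> x A o\<^sub>L \<alpha> x B"
    and \<alpha>_semigroup: "y \<in> P \<Longrightarrow> \<alpha> x (\<alpha> y A) = \<alpha> (x + y) A"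
  using E0 assms unfolding E0_semigroup_def unital_star_endomorphism_def by (auto simp: Pi_iff)

lemma weakly_continuous_\<alpha>: "A \<in> BH \<Longrightarrow> continuous_on P (\<lambda>x. cinner (\<alpha> x A \<xi>) \<eta>)"
  using E0 by (simp add: E0_semigroup_def)

text \<open>Weak continuity improves to norm continuity because \<open>\<parallel>\<alpha>\<^sub>y(A)\<xi>\<parallel>\<^sup>2 = \<langle>\<alpha>\<^sub>y(A\<^sup>*A)\<xi>|\<xi>\<rangle>\<close> is continuous
  too: weak convergence together with convergence of norms is norm convergence.\<close>

lemma strongly_continuous_\<alpha>:
  assumes A: "A \<in> BH"
  shows "continuous_on P (\<lambda>x. \<alpha> x A \<xi>)"
  unfolding continuous_on_def
proof
  fix x assume x: "x \<in> P"
  let ?F = "at x within P"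
  have w: "((\<lambda>y. cinner (\<alpha> y B \<eta>) \<zeta>) \<longlongrightarrow> cinner (\<alpha> x B \<eta>) \<zeta>) ?F" if "B \<in> BH" for B \<eta> \<zeta>
    using weakly_continuous_\<alpha>[OF that] x by (auto simp: continuous_on_def)
  have BH: "adj A o\<^sub>L A \<in> BH" by (intro compose_in_BH adj_in_BH A)
  have norm2: "(norm (\<alpha> y A \<xi>))\<^sup>2 = Re (cinner (\<alpha> y (adj A o\<^sub>L A) \<xi>) \<xi>)" if "y \<in> P" for y
  proof -
    have "cinner (\<alpha> y (adj A o\<^sub>L A) \<xi>) \<xi> = cinner (\<alpha> y A \<xi>) (\<alpha> y A \<xi>)"
      using that A by (simp add: \<alpha>_compose adj_in_BH \<alpha>_adj \<alpha>_BH cinner_adj_left)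
    then show ?thesis by (simp add: cinner_self)
  qed
  have "((\<lambda>y. Re (cinner (\<alpha> y (adj A o\<^sub>L A) \<xi>) \<xi>) - 2 * Re (cinner (\<alpha> y A \<xi>) (\<alpha> x A \<xi>))
          + (norm (\<alpha> x A \<xi>))\<^sup>2)
        \<longlongrightarrow> Re (cinner (\<alpha> x (adj A o\<^sub>L A) \<xi>) \<xi>) - 2 * Re (cinner (\<alpha> x A \<xi>) (\<alpha> x A \<xi>))
          + (norm (\<alpha> x A \<xi>))\<^sup>2) ?F"
    by (intro tendsto_intros w A BH)
  then have "((\<lambda>y. Re (cinner (\<alpha> y (adj A o\<^sub>L A) \<xi>) \<xi>) - 2 * Re (cinner (\<alpha> y A \<xi>) (\<alpha> x A \<xi>))
          + (norm (\<alpha> x A \<xi>))\<^sup>2) \<longlongrightarrow> 0) ?F"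
    by (simp add: norm2[OF x, symmetric] cinner_self)
  moreover have "(norm (a - b))\<^sup>2 = (norm a)\<^sup>2 - 2 * Re (cinner a b) + (norm b)\<^sup>2" for a b :: 'h
    by (simp add: Re_cinner power2_norm_eq_inner inner_diff_left inner_diff_right inner_commute)
  then have "\<forall>\<^sub>F y in ?F. Re (cinner (\<alpha> y (adj A o\<^sub>L A) \<xi>) \<xi>) - 2 * Re (cinner (\<alpha> y A \<xi>) (\<alpha> x A \<xi>))
          + (norm (\<alpha> x A \<xi>))\<^sup>2 = (norm (\<alpha> y A \<xi> - \<alpha> x A \<xi>))\<^sup>2"
    unfolding eventually_at_filter
    by (intro always_eventually) (auto simp: norm2)
  ultimately have "((\<lambda>y. (norm (\<alpha> y A \<xi> - \<alpha> x A \<xi>))\<^sup>2) \<longlongrightarrow> 0) ?F"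
    by (rule Lim_transform_eventually)
  then have "((\<lambda>y. norm (\<alpha> y A \<xi> - \<alpha> x A \<xi>)) \<longlongrightarrow> 0) ?F"
    using tendsto_real_sqrt[of _ 0] by fastforce
  then show "((\<lambda>y. \<alpha> y A \<xi>) \<longlongrightarrow> \<alpha> x A \<xi>) ?F"
    by (metis LIM_zero_cancel tendsto_norm_zero_cancel)
qed

lemma E_compose:
  assumes "x \<in> P" "y \<in> P" "S \<in> E x" "T \<in> E y"
  shows "S o\<^sub>L T \<in> E (x + y)"
  using assms
  by (intro product_systemI compose_in_BH)
    (auto simp: product_system_BH intertwine \<alpha>_semigroup[symmetric] \<alpha>_BH)

lemma E_scaleC: "x \<in> P \<Longrightarrow> T \<in> E x \<Longrightarrow> c *\<^sub>C T \<in> E x"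
  by (intro product_systemI scaleC_in_BH)
    (auto simp: product_system_BH intertwine BH_scaleC \<alpha>_BH)

lemma E_diff: "S \<in> E x \<Longrightarrow> T \<in> E x \<Longrightarrow> S - T \<in> E x"
  by (intro product_systemI diff_in_BH)
    (auto simp: product_system_BH intertwine blinfun.diff_left blinfun.diff_right)

lemma adj_intertwine:
  assumes "x \<in> P" "T \<in> E x" "A \<in> BH"
  shows "adj T (\<alpha> x A \<xi>) = A (adj T \<xi>)"
proof (rule cinner_extensionality)
  fix \<zeta>
  note BH = product_system_BH[OF assms(2)] \<alpha>_BH[OF assms(1,3)] adj_in_BH[OF assms(3)]
  have "cinner (adj T (\<alpha> x A \<xi>)) \<zeta> = cinner \<xi> (adj (\<alpha> x A) (T \<zeta>))"
    using BH by (simp add: cinner_adj_left cinner_adj_right)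
  also have "\<dots> = cinner \<xi> (T (adj A \<zeta>))"
    using assms BH by (simp add: \<alpha>_adj[symmetric] intertwine)
  also have "\<dots> = cinner (A (adj T \<xi>)) \<zeta>"
    using BH assms(3) by (metis cinner_adj_left cinner_adj_right)
  finally show "cinner (adj T (\<alpha> x A \<xi>)) \<zeta> = cinner (A (adj T \<xi>)) \<zeta>" .
qed

text \<open>Composition with \<open>a\<^sup>*\<close> strips a left factor \<open>a\<close> from a fibre vector.\<close>

lemma adj_compose_in_E:
  assumes "y \<in> P" "z \<in> P" "a \<in> E y" "v \<in> E (y + z)"
  shows "adj a o\<^sub>L v \<in> E z"
proof (rule product_systemI)
  fix A :: "'h \<Rightarrow>\<^sub>L 'h" and \<xi> assume A: "A \<in> BH"
  have "\<alpha> z A ((adj a o\<^sub>L v) \<xi>) = adj a (\<alpha> y (\<alpha> z A) (v \<xi>))"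
    using assms A by (simp add: adj_intertwine \<alpha>_BH)
  also have "\<dots> = (adj a o\<^sub>L v) (A \<xi>)"
    using assms A by (simp add: \<alpha>_semigroup intertwine)
  finally show "\<alpha> z A ((adj a o\<^sub>L v) \<xi>) = (adj a o\<^sub>L v) (A \<xi>)" .
next
  show "adj a o\<^sub>L v \<in> BH"
    using assms(3,4) by (intro compose_in_BH adj_in_BH) (auto dest: product_system_BH)
qed

text \<open>For \<open>S, T\<close> in one fibre, \<open>T\<^sup>*S A = T\<^sup>*\<alpha>\<^sub>x(A)S = A T\<^sup>*S\<close>, so \<open>T\<^sup>*S\<close> lies in the commutant of \<open>B(H)\<close>.\<close>

lemma ps_inner:
  assumes x: "x \<in> P" and S: "S \<in> E x" and T: "T \<in> E x"
  shows "adj T o\<^sub>L S = ps_inner S T *\<^sub>C id_blinfun"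
proof -
  obtain \<zeta> :: 'h where \<zeta>: "\<zeta> \<noteq> 0" using nontrivial by blast
  have "\<exists>c. adj T o\<^sub>L S = c *\<^sub>C id_blinfun"
  proof (rule commutant_BH[OF _ \<zeta>])
    fix A :: "'h \<Rightarrow>\<^sub>L 'h" assume A: "A \<in> BH"
    have "A (adj T (S \<xi>)) = adj T (S (A \<xi>))" for \<xi>
      using adj_intertwine[OF x T A, of "S \<xi>"] intertwine[OF S A, of \<xi>] by simp
    then show "A o\<^sub>L (adj T o\<^sub>L S) = (adj T o\<^sub>L S) o\<^sub>L A"
      by (intro blinfun_eqI) simp
  qed
  then obtain c where c: "c *\<^sub>C id_blinfun = adj T o\<^sub>L S" by metis
  have "ps_inner S T *\<^sub>C id_blinfun = adj T o\<^sub>L S"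
    unfolding ps_inner_def
  proof (rule theI[of _ c])
    fix d assume "d *\<^sub>C id_blinfun = adj T o\<^sub>L S"
    then have "blinfun_apply (d *\<^sub>C id_blinfun) \<zeta> = blinfun_apply (c *\<^sub>C id_blinfun) \<zeta>"
      using c by simp
    then show "d = c"
      using \<zeta> by simp
  qed (rule c)
  then show ?thesis by simp
qed

text \<open>This identity turns inner products in the fibre into inner products of vectors, so
  that continuity of \<open>\<langle>u\<^sub>x|v\<^sub>x\<rangle>\<close> can be read off from that of \<open>u\<^sub>x\<xi>\<close> and \<open>v\<^sub>x\<xi>\<close>.\<close>

lemma cinner_E:
  assumes "x \<in> P" "S \<in> E x" "T \<in> E x"
  shows "cinner (S \<xi>) (T \<eta>) = ps_inner S T * cinner \<xi> \<eta>"
proof -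
  have "cinner (S \<xi>) (T \<eta>) = cinner ((adj T o\<^sub>L S) \<xi>) \<eta>"
    using assms by (simp add: cinner_adj_left product_system_BH)
  then show ?thesis
    by (simp add: ps_inner[OF assms] cinner_scaleC_left)
qed

lemma ps_inner_eqI:
  assumes "x \<in> P" "S \<in> E x" "T \<in> E x" "\<And>\<xi> \<eta>. cinner (S \<xi>) (T \<eta>) = c * cinner \<xi> \<eta>"
  shows "ps_inner S T = c"
proof -
  obtain \<zeta> :: 'h where "\<zeta> \<noteq> 0" using nontrivial by blast
  then show ?thesis
    using assms(4)[of \<zeta> \<zeta>] cinner_E[OF assms(1-3), of \<zeta> \<zeta>] by simp
qed

lemma
  assumes "x \<in> P" "S \<in> E x" "T \<in> E x"
  shows ps_inner_commute: "ps_inner S T = cnj (ps_inner T S)"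
    and ps_inner_scaleC_left: "ps_inner (c *\<^sub>C S) T = c * ps_inner S T"
    and ps_inner_scaleC_right: "ps_inner S (c *\<^sub>C T) = cnj c * ps_inner S T"
proof -
  show "ps_inner S T = cnj (ps_inner T S)"
  proof (rule ps_inner_eqI[OF assms])
    fix \<xi> \<eta>
    have "cinner (S \<xi>) (T \<eta>) = cnj (cinner (T \<eta>) (S \<xi>))" by (rule cinner_commute)
    also have "\<dots> = cnj (ps_inner T S) * cinner \<xi> \<eta>"
      using assms cinner_commute[of \<xi> \<eta>] by (simp add: cinner_E)
    finally show "cinner (S \<xi>) (T \<eta>) = cnj (ps_inner T S) * cinner \<xi> \<eta>" .
  qed
  show "ps_inner (c *\<^sub>C S) T = c * ps_inner S T"
    using assms by (intro ps_inner_eqI[of x] E_scaleC) (simp_all add: cinner_E cinner_scaleC_left)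
  show "ps_inner S (c *\<^sub>C T) = cnj c * ps_inner S T"
    using assms by (intro ps_inner_eqI[of x] E_scaleC) (simp_all add: cinner_E cinner_scaleC_right)
qed

lemma ps_inner_compose:
  assumes "x \<in> P" "y \<in> P" "S \<in> E x" "S' \<in> E x" "T \<in> E y" "T' \<in> E y"
  shows "ps_inner (S o\<^sub>L T) (S' o\<^sub>L T') = ps_inner S S' * ps_inner T T'"
  using assms by (intro ps_inner_eqI[of "x + y"] E_compose add_in_P) (simp_all add: cinner_E)

lemma norm_E:
  assumes "x \<in> P" "T \<in> E x"
  shows "norm (T \<xi>) = ps_norm T * norm \<xi>"
    and ps_inner_self: "ps_inner T T = complex_of_real ((ps_norm T)\<^sup>2)"
proof -
  obtain \<zeta> :: 'h where \<zeta>: "\<zeta> \<noteq> 0" using nontrivial by blast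
  have 1: "complex_of_real ((norm (T \<eta>))\<^sup>2) = ps_inner T T * complex_of_real ((norm \<eta>)\<^sup>2)" for \<eta>
    using cinner_E[OF assms(1,2,2), of \<eta> \<eta>] by (simp only: cinner_self)
  have "ps_inner T T = complex_of_real ((norm (T \<zeta>))\<^sup>2 / (norm \<zeta>)\<^sup>2)"
    using 1[of \<zeta>] \<zeta> by simp
  then obtain r where r: "ps_inner T T = complex_of_real r" "r \<ge> 0"
    by (metis divide_nonneg_nonneg zero_le_power2)
  then show 2: "ps_inner T T = complex_of_real ((ps_norm T)\<^sup>2)"
    by (simp add: ps_norm_def)
  have "(norm (T \<xi>))\<^sup>2 = (ps_norm T * norm \<xi>)\<^sup>2"
    using 1[of \<xi>] unfolding 2 of_real_mult[symmetric] of_real_eq_iff power_mult_distrib .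
  moreover have "ps_norm T \<ge> 0"
    using r by (simp add: ps_norm_def)
  ultimately show "norm (T \<xi>) = ps_norm T * norm \<xi>"
    by (simp add: power2_eq_iff_nonneg)
qed

lemma ps_norm_pos:
  assumes "x \<in> P" "T \<in> E x" "T \<noteq> 0"
  shows "ps_norm T > 0"
proof -
  obtain \<zeta> where "T \<zeta> \<noteq> 0"
    using assms(3) blinfun_eqI[of T 0] by auto
  then show ?thesis
    using norm_E(1)[OF assms(1,2), of \<zeta>] by (metis mult_pos_pos norm_ge_zero norm_le_zero_iff not_le zero_less_mult_iff)
qed

lemma E_injective: "x \<in> P \<Longrightarrow> T \<in> E x \<Longrightarrow> T \<noteq> 0 \<Longrightarrow> T \<xi> = 0 \<Longrightarrow> \<xi> = 0"
  using norm_E(1)[of x T \<xi>] ps_norm_pos[of x T] by simp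

lemma E_compose_nonzero:
  assumes "x \<in> P" "y \<in> P" "S \<in> E x" "T \<in> E y" "S \<noteq> 0" "T \<noteq> 0"
  shows "S o\<^sub>L T \<noteq> 0"
proof
  assume 0: "S o\<^sub>L T = 0"
  obtain \<zeta> :: 'h where "\<zeta> \<noteq> 0" using nontrivial by blast
  moreover have "S (T \<zeta>) = 0"
    using arg_cong[OF 0, of "\<lambda>R. blinfun_apply R \<zeta>"] by simp
  ultimately show False
    using E_injective assms by blast
qed

lemma adj_compose_self:
  assumes "x \<in> P" "a \<in> E x"
  shows "adj a (a \<xi>) = complex_of_real ((ps_norm a)\<^sup>2) *\<^sub>C \<xi>"
  using arg_cong[OF ps_inner[OF assms(1,2,2)], of "\<lambda>R. blinfun_apply R \<xi>"]
  by (simp add: ps_inner_self[OF assms])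

section \<open>Factors of decomposable vectors\<close>

text \<open>Two left factors of one vector are comparable: up to the factor \<open>\<parallel>a\<parallel>\<^sup>2\<close>, \<open>t = a\<^sup>*v\<close> satisfies
  \<open>t w = a\<^sup>*(a b) = b\<close>, hence \<open>(v - a t) w = 0\<close>, and right multiplication by a nonzero \<open>w\<close> is injective
  on a fibre. For \<open>z = 0\<close> this says that a left factor is unique up to a scalar.\<close>

lemma left_factor_unique:
  assumes P: "y \<in> P" "z \<in> P" "r \<in> P"
    and a: "a \<in> E y" "a \<noteq> 0" and v: "v \<in> E (y + z)" and w: "w \<in> E r" "w \<noteq> 0"
    and eq: "a o\<^sub>L b = v o\<^sub>L w"
  obtains t where "t \<in> E z" "v = a o\<^sub>L t"
proof -
  define k where "k = inverse (complex_of_real ((ps_norm a)\<^sup>2))"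
  have k: "k * complex_of_real ((ps_norm a)\<^sup>2) = 1"
    using ps_norm_pos[OF P(1) a] by (simp add: k_def)
  define t where "t = k *\<^sub>C (adj a o\<^sub>L v)"
  have t: "t \<in> E z"
    unfolding t_def by (intro E_scaleC adj_compose_in_E[of y] P a v)
  have "v - (a o\<^sub>L t) = 0"
  proof (rule ccontr)
    assume nz: "v - (a o\<^sub>L t) \<noteq> 0"
    have "v - (a o\<^sub>L t) \<in> E (y + z)"
      by (rule E_diff[OF v E_compose[OF P(1,2) a(1) t]])
    then have "(v - (a o\<^sub>L t)) o\<^sub>L w \<noteq> 0"
      by (rule E_compose_nonzero[OF add_in_P[OF P(1,2)] P(3) _ w(1) nz w(2)])
    moreover have "((v - (a o\<^sub>L t)) o\<^sub>L w) \<xi> = 0" for \<xi>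
    proof -
      have eq': "v (w \<xi>) = a (b \<xi>)"
        using arg_cong[OF eq, of "\<lambda>R. blinfun_apply R \<xi>"] by simp
      have "t (w \<xi>) = b \<xi>"
        using k by (simp add: t_def eq' adj_compose_self[OF P(1) a(1)] scaleC_scaleC scaleC_one)
      then show ?thesis
        by (simp add: blinfun.diff_left eq')
    qed
    ultimately show False
      by (auto intro: blinfun_eqI)
  qed
  then show ?thesis
    using that t by simp
qed

lemma D_E: "u \<in> D x \<Longrightarrow> u \<in> E x" and D_nonzero: "u \<in> D x \<Longrightarrow> u \<noteq> 0"
  by (simp_all add: decomposables_def)

lemma D_factor:
  assumes "u \<in> D x" "y \<in> P" "x - y \<in> P"
  obtains v w where "v \<in> E y" "w \<in> E (x - y)" "u = v o\<^sub>L w"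
  using assms unfolding decomposables_def cone_le_def by blast

lemma D_compose: "x \<in> P \<Longrightarrow> y \<in> P \<Longrightarrow> u \<in> D x \<Longrightarrow> v \<in> D y \<Longrightarrow> u o\<^sub>L v \<in> D (x + y)"
  using decomposable by (simp add: decomposable_E0_semigroup_def)

lemma D_scaleC:
  assumes x: "x \<in> P" and u: "u \<in> D x" and "c \<noteq> 0"
  shows "c *\<^sub>C u \<in> D x"
  unfolding decomposables_def mem_Collect_eq
proof (intro conjI ballI impI)
  show "c *\<^sub>C u \<in> E x" "c *\<^sub>C u \<noteq> 0"
    using assms by (auto intro: E_scaleC simp: D_E D_nonzero)
  fix y assume y: "y \<in> P" "cone_le P y x"
  then obtain v w where "v \<in> E y" "w \<in> E (x - y)" "u = v o\<^sub>L w"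
    using D_factor[OF u] by (auto simp: cone_le_def)
  then show "\<exists>v\<in>E y. \<exists>w\<in>E (x - y). c *\<^sub>C u = v o\<^sub>L w"
    using y E_scaleC[of y v c] by (metis scaleC_compose_left)
qed

text \<open>A decomposition of \<open>u\<close> at an earlier point \<open>y\<close> restricts to one of the factor \<open>v\<close>, by comparability
  of left factors.\<close>

lemma left_factor_in_D:
  assumes u: "u \<in> D x" "u = v o\<^sub>L w" and v: "v \<in> E z" and w: "w \<in> E (x - z)"
    and P: "z \<in> P" "x - z \<in> P"
  shows "v \<in> D z"
proof -
  have nz: "v \<noteq> 0" "w \<noteq> 0"
    using u D_nonzero[OF u(1)] by auto
  have "\<exists>a\<in>E y. \<exists>t\<in>E (z - y). v = a o\<^sub>L t" if y: "y \<in> P" "z - y \<in> P" for y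
  proof -
    have "x - y \<in> P"
      using add_in_P[OF y(2) P(2)] by simp
    then obtain a b where ab: "a \<in> E y" "u = a o\<^sub>L b"
      using D_factor[OF u(1) y(1)] by metis
    then have "a \<noteq> 0" using D_nonzero[OF u(1)] by auto
    have "v \<in> E (y + (z - y))" "a o\<^sub>L b = v o\<^sub>L w"
      using v ab(2) u(2) by simp_all
    then obtain t where "t \<in> E (z - y)" "v = a o\<^sub>L t"
      using left_factor_unique[of y "z - y" "x - z" a v w b] y P ab(1) \<open>a \<noteq> 0\<close> w nz(2) by metis
    then show ?thesis using ab(1) by blast
  qed
  then show ?thesis
    using v nz by (auto simp: decomposables_def cone_le_def)
qed

text \<open>If \<open>u = a w = p q\<close> with \<open>p\<close> in the fibre over \<open>z + y\<close>, then \<open>w\<close> is a multiple of \<open>a\<^sup>*u = (a\<^sup>*p) q\<close>.\<close>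

lemma right_factor_in_D:
  assumes u: "u \<in> D x" "u = a o\<^sub>L w" and a: "a \<in> E z" and w: "w \<in> E (x - z)"
    and P: "z \<in> P" "x - z \<in> P"
  shows "w \<in> D (x - z)"
proof -
  have nz: "a \<noteq> 0" "w \<noteq> 0"
    using u D_nonzero[OF u(1)] by auto
  have "\<exists>p\<in>E y. \<exists>q\<in>E (x - z - y). w = p o\<^sub>L q" if y: "y \<in> P" "x - z - y \<in> P" for y
  proof -
    have "z + y \<in> P" "x - (z + y) \<in> P"
      using add_in_P[OF P(1) y(1)] y(2) by (simp_all add: diff_diff_eq)
    then obtain p q where pq: "p \<in> E (z + y)" "q \<in> E (x - (z + y))" "u = p o\<^sub>L q"
      using D_factor[OF u(1)] by metis
    define k where "k = inverse (complex_of_real ((ps_norm a)\<^sup>2))"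
    have k: "k * complex_of_real ((ps_norm a)\<^sup>2) = 1"
      using ps_norm_pos[OF P(1) a nz(1)] by (simp add: k_def)
    have "w = (k *\<^sub>C (adj a o\<^sub>L p)) o\<^sub>L q"
    proof (rule blinfun_eqI)
      fix \<xi>
      have "p (q \<xi>) = a (w \<xi>)"
        using pq(3) u(2) by (metis blinfun_apply_blinfun_compose)
      then show "w \<xi> = ((k *\<^sub>C (adj a o\<^sub>L p)) o\<^sub>L q) \<xi>"
        using k by (simp add: adj_compose_self[OF P(1) a] scaleC_scaleC scaleC_one)
    qed
    moreover have "k *\<^sub>C (adj a o\<^sub>L p) \<in> E y"
      by (intro E_scaleC adj_compose_in_E[of z] P y a pq)
    ultimately show ?thesis
      using pq(2) by (auto simp: diff_diff_eq)
  qed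
  then show ?thesis
    using w nz by (auto simp: decomposables_def cone_le_def)
qed

end

section \<open>Left coherent sections\<close>

lemma cinner_nonzero_of_near_common_direction:
  fixes \<zeta> a b :: "'h::complex_hilbert"
  assumes norms: "norm \<zeta> = 1" "norm a = 1" "norm b = 1"
    and near: "norm (c *\<^sub>C \<zeta> - a) < 1/4" "norm (d *\<^sub>C \<zeta> - b) < 1/4"
  shows "cinner a b \<noteq> 0"
proof
  assume 0: "cinner a b = 0"
  have c: "cmod c \<ge> 3/4" and d: "cmod d \<ge> 3/4"
    using norm_triangle_ineq2[of a "c *\<^sub>C \<zeta>"] norm_triangle_ineq2[of b "d *\<^sub>C \<zeta>"] norms near
    by (simp_all add: norm_scaleC norm_minus_commute)
  have "cinner (c *\<^sub>C \<zeta>) (d *\<^sub>C \<zeta>) = c * cnj d"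
    using norms by (simp add: cinner_scaleC_left cinner_scaleC_right cinner_self)
  then have "c * cnj d = cinner (c *\<^sub>C \<zeta> - a) b + cinner (c *\<^sub>C \<zeta>) (d *\<^sub>C \<zeta> - b)"
    by (simp add: cinner_diff_left cinner_diff_right 0)
  then have "cmod (c * cnj d) \<le> norm (c *\<^sub>C \<zeta> - a) * norm b + norm (c *\<^sub>C \<zeta>) * norm (d *\<^sub>C \<zeta> - b)"
    by (metis cmod_cinner_le norm_triangle_mono)
  also have "\<dots> \<le> 1/4 + cmod c * (1/4)"
    using norms near by (intro add_mono mult_mono) (simp_all add: norm_scaleC)
  finally have "cmod c * cmod d \<le> 1/4 + cmod c * (1/4)"
    by (simp add: norm_mult)
  moreover have "cmod c * (3/4) \<le> cmod c * cmod d"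
    using d by (intro mult_left_mono) auto
  ultimately show False using c by linarith
qed

lemma ray_scaleC: "c \<noteq> 0 \<Longrightarrow> ray (c *\<^sub>C u) = ray u"
  unfolding ray_def
  by (auto simp: scaleC_scaleC) (metis divide_eq_0_iff nonzero_eq_divide_eq)

lemma ray_eqD: "ray u = ray v \<Longrightarrow> \<exists>c. c \<noteq> 0 \<and> u = c *\<^sub>C v"
proof -
  assume "ray u = ray v"
  moreover have "u \<in> ray u"
    unfolding ray_def mem_Collect_eq by (rule exI[of _ 1]) (simp add: scaleC_one)
  ultimately show ?thesis by (auto simp: ray_def)
qed

lemma blinfun_compose_assoc: "(A o\<^sub>L B) o\<^sub>L C = A o\<^sub>L (B o\<^sub>L C)"
  by (rule blinfun_eqI) simp

context decomposable_semigroup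
begin

lemma interior_P_nonempty: "interior P \<noteq> {}"
proof
  assume "interior P = {}"
  then obtain a b where ab: "a \<noteq> 0" "P \<subseteq> {x. inner a x = b}"
    using empty_interior_subset_hyperplane[OF convex_P] by metis
  have "a \<in> {x - y | x y. x \<in> P \<and> y \<in> P}"
    using cone by (simp add: closed_pointed_generating_cone_def)
  then obtain p q where "a = p - q" "p \<in> P" "q \<in> P" by blast
  then have "inner a a = 0"
    using ab(2) by (auto simp: inner_diff_right subset_iff)
  then show False using ab(1) by simp
qed

lemma interior_subset_P: "x \<in> interior P \<Longrightarrow> x \<in> P"
  using interior_subset by blast

lemma left_coherentD:
  assumes "left_coherent P \<alpha> u"
  shows left_coherent_D: "x \<in> P \<Longrightarrow> u x \<in> D x"
    and left_coherent_E: "x \<in> P \<Longrightarrow> u x \<in> E x"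
    and left_coherent_nonzero: "x \<in> P \<Longrightarrow> u x \<noteq> 0"
    and left_coherent_factor: "\<lbrakk>x \<in> P; y \<in> P; x - y \<in> P\<rbrakk> \<Longrightarrow> \<exists>w\<in>D (x - y). u x = u y o\<^sub>L w"
  using assms by (auto simp: left_coherent_def cone_le_def D_E D_nonzero)

lemma unit_left_coherent_left_coherent: "unit_left_coherent P \<alpha> u \<Longrightarrow> left_coherent P \<alpha> u"
  by (simp add: unit_left_coherent_def)

lemma left_coherent_scaleC:
  assumes u: "left_coherent P \<alpha> u" and c: "\<And>x. x \<in> P \<Longrightarrow> c x \<noteq> 0"
  shows "left_coherent P \<alpha> (\<lambda>x. c x *\<^sub>C u x)"
  unfolding left_coherent_def
proof (intro conjI ballI impI)
  show "c x *\<^sub>C u x \<in> D x" if "x \<in> P" for x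
    using that by (intro D_scaleC c left_coherent_D[OF u])
  fix x y assume xy: "x \<in> P" "y \<in> P" "cone_le P y x"
  then obtain w where w: "w \<in> D (x - y)" "u x = u y o\<^sub>L w"
    using left_coherent_factor[OF u] by (auto simp: cone_le_def)
  show "\<exists>w\<in>D (x - y). c x *\<^sub>C u x = (c y *\<^sub>C u y) o\<^sub>L w"
  proof
    show "(c x / c y) *\<^sub>C w \<in> D (x - y)"
      using xy c w by (intro D_scaleC) (auto simp: cone_le_def)
    have "u y \<in> BH"
      using left_coherent_E[OF u xy(2)] by (rule product_system_BH)
    then show "c x *\<^sub>C u x = (c y *\<^sub>C u y) o\<^sub>L (c x / c y) *\<^sub>C w"
      using c[OF xy(2)] w(2) by (simp add: scaleC_compose_left scaleC_compose_right scaleC_scaleC)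
  qed
qed

lemma unit_left_coherent_normalize:
  assumes u: "left_coherent P \<alpha> u"
  shows "unit_left_coherent P \<alpha> (\<lambda>x. complex_of_real (1 / ps_norm (u x)) *\<^sub>C u x)"
proof -
  have pos: "ps_norm (u x) > 0" if "x \<in> P" for x
    using that left_coherent_E[OF u] left_coherent_nonzero[OF u] ps_norm_pos by blast
  have "ps_norm (complex_of_real (1 / ps_norm (u x)) *\<^sub>C u x) = 1" if x: "x \<in> P" for x
  proof -
    note E = left_coherent_E[OF u x]
    have "ps_inner (complex_of_real (1 / ps_norm (u x)) *\<^sub>C u x) (complex_of_real (1 / ps_norm (u x)) *\<^sub>C u x)
      = complex_of_real (1 / ps_norm (u x)) * complex_of_real (1 / ps_norm (u x)) * complex_of_real ((ps_norm (u x))\<^sup>2)"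
      using x E ps_inner_self[OF x E]
      by (simp only: ps_inner_scaleC_left ps_inner_scaleC_right E_scaleC complex_cnj_complex_of_real mult.assoc)
    also have "\<dots> = 1"
      using pos[OF x] by (simp add: power2_eq_square)
    finally show ?thesis by (simp add: ps_norm_def)
  qed
  then show ?thesis
    using pos less_irrefl unfolding unit_left_coherent_def
    by (intro conjI left_coherent_scaleC u) fastforce+
qed

text \<open>The rays of \<open>u\<^sub>y\<zeta>\<close> move continuously, whatever the scalars in \<open>u\<close>. Take \<open>z\<close> above
  all \<open>y\<close> near \<open>x\<close> and write \<open>u\<^sub>z = u\<^sub>y w\<^sub>y\<close>. For a rank-one operator \<open>A\<close> with range spanned by \<open>\<zeta>\<close>,
  \<open>\<alpha>\<^sub>y(A) u\<^sub>z \<zeta>\<^sub>0 = u\<^sub>y A w\<^sub>y \<zeta>\<^sub>0 = c\<^sub>y u\<^sub>y\<zeta>\<close>, where the left-hand side is continuous in \<open>y\<close> and the scalar does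
  not depend on \<open>\<zeta>\<close>.\<close>

lemma continuous_up_to_scalars:
  assumes u: "left_coherent P \<alpha> u" and x: "x \<in> P"
  obtains c where "c x = (1::complex)" "\<And>\<zeta>. continuous (at x within P) (\<lambda>y. c y *\<^sub>C u y \<zeta>)"
proof -
  obtain p where p: "p \<in> interior P" using interior_P_nonempty by blast
  define z where "z = x + p"
  have z: "z \<in> P" using x p by (simp add: z_def add_in_P interior_subset_P)
  define w where "w y = (SOME w. w \<in> D (z - y) \<and> u z = u y o\<^sub>L w)" for y
  have w: "w y \<in> D (z - y)" "u z = u y o\<^sub>L w y" if "y \<in> P" "z - y \<in> P" for y
  proof -
    have "\<exists>w. w \<in> D (z - y) \<and> u z = u y o\<^sub>L w"
      using left_coherent_factor[OF u z that] by blast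
    from someI_ex[OF this] show "w y \<in> D (z - y)" "u z = u y o\<^sub>L w y"
      by (simp_all add: w_def)
  qed
  obtain \<zeta>\<^sub>0 :: 'h where \<zeta>0: "\<zeta>\<^sub>0 \<noteq> 0" using nontrivial by blast
  define \<eta> where "\<eta> = w x \<zeta>\<^sub>0"
  have zx: "z - x \<in> P" using p by (simp add: z_def interior_subset_P)
  have \<eta>: "\<eta> \<noteq> 0"
    using E_injective[OF zx D_E D_nonzero] w(1)[OF x zx] \<zeta>0 by (auto simp: \<eta>_def)
  define k where "k = inverse (cinner \<eta> \<eta>)"
  define c where "c y = cinner (w y \<zeta>\<^sub>0) \<eta> * k" for y
  show ?thesis
  proof
    show cx: "c x = 1"
      using \<eta> by (simp add: c_def k_def \<eta>_def)
    fix \<zeta>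
    \<comment> \<open>This operator sends \<open>w y \<zeta>\<^sub>0\<close> to \<open>c y *\<^sub>C \<zeta>\<close>.\<close>
    define A where "A = rank_one (k *\<^sub>C \<zeta>) \<eta>"
    have \<alpha>A: "\<alpha> y A (u z \<zeta>\<^sub>0) = c y *\<^sub>C u y \<zeta>" if y: "y \<in> P" "z - y \<in> P" for y
    proof -
      have uy: "u y \<in> E y" by (rule left_coherent_E[OF u y(1)])
      have "\<alpha> y A (u z \<zeta>\<^sub>0) = u y (A (w y \<zeta>\<^sub>0))"
        by (simp add: w(2)[OF y] intertwine[OF uy] A_def)
      then show ?thesis
        by (simp add: A_def c_def scaleC_scaleC BH_scaleC[OF product_system_BH[OF uy]])
    qed
    have "((\<lambda>y. z - y) \<longlongrightarrow> z - x) (at x within P)"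
      by (intro tendsto_intros)
    moreover have "z - x \<in> interior P" using p by (simp add: z_def)
    ultimately have "\<forall>\<^sub>F y in at x within P. z - y \<in> interior P"
      using topological_tendstoD open_interior by blast
    moreover have "\<forall>\<^sub>F y in at x within P. y \<in> P"
      by (simp add: eventually_at_filter)
    ultimately have ev: "\<forall>\<^sub>F y in at x within P. \<alpha> y A (u z \<zeta>\<^sub>0) = c y *\<^sub>C u y \<zeta>"
      by eventually_elim (simp add: \<alpha>A interior_subset_P)
    have "((\<lambda>y. \<alpha> y A (u z \<zeta>\<^sub>0)) \<longlongrightarrow> \<alpha> x A (u z \<zeta>\<^sub>0)) (at x within P)"
      using strongly_continuous_\<alpha>[of A "u z \<zeta>\<^sub>0"] x by (simp add: A_def continuous_on_def)
    then have "((\<lambda>y. c y *\<^sub>C u y \<zeta>) \<longlongrightarrow> \<alpha> x A (u z \<zeta>\<^sub>0)) (at x within P)"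
      by (rule Lim_transform_eventually[OF _ ev])
    then show "continuous (at x within P) (\<lambda>y. c y *\<^sub>C u y \<zeta>)"
      by (simp add: continuous_within \<alpha>A[OF x zx])
  qed
qed

text \<open>For \<open>0 \<noteq> T \<in> E(0)\<close>, \<open>T \<alpha>\<^sub>0(A) = \<alpha>\<^sub>0(\<alpha>\<^sub>0(A)) T = \<alpha>\<^sub>0(A) T = T A\<close> and injectivity of \<open>T\<close> force \<open>\<alpha>\<^sub>0(A) = A\<close>.
  So \<open>T\<close> commutes with \<open>B(H)\<close>.\<close>

lemma E_zero:
  assumes T: "T \<in> E 0"
  shows "\<exists>c. T = c *\<^sub>C id_blinfun"
proof (cases "T = 0")
  case True
  then show ?thesis by (metis complex_vector.scale_zero_left)
next
  case False
  obtain \<zeta> :: 'h where \<zeta>: "\<zeta> \<noteq> 0" using nontrivial by blast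
  show ?thesis
  proof (rule commutant_BH[OF _ \<zeta>], rule blinfun_eqI)
    fix A :: "'h \<Rightarrow>\<^sub>L 'h" and \<xi> assume A: "A \<in> BH"
    have "T (\<alpha> 0 A \<eta>) = T (A \<eta>)" for \<eta>
      using intertwine[OF T \<alpha>_BH[OF zero_in_P A], of \<eta>] intertwine[OF T A, of \<eta>]
        \<alpha>_semigroup[OF zero_in_P A zero_in_P] by simp
    then have "\<alpha> 0 A \<eta> = A \<eta>" for \<eta>
      using E_injective[OF zero_in_P T False, of "\<alpha> 0 A \<eta> - A \<eta>"] by (simp add: blinfun.diff_right)
    then show "(A o\<^sub>L T) \<xi> = (T o\<^sub>L A) \<xi>"
      using intertwine[OF T A, of \<xi>] by simp
  qed
qed

lemma E_zero_inner:
  assumes "S \<in> E 0" "T \<in> E 0" "S \<noteq> 0" "T \<noteq> 0"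
  shows "ps_inner S T \<noteq> 0"
proof -
  obtain a b where ab: "S = a *\<^sub>C id_blinfun" "T = b *\<^sub>C id_blinfun"
    using E_zero assms by metis
  then have "ps_inner S T = a * cnj b"
    using assms by (intro ps_inner_eqI[of 0]) (simp_all add: cinner_scaleC_left cinner_scaleC_right)
  then show ?thesis using assms ab by auto
qed

text \<open>Along the segment from \<open>0\<close> to \<open>x\<close>, whether \<open>\<langle>u\<^sub>s|v\<^sub>s\<rangle>\<close> vanishes is locally constant. Since
  \<open>\<langle>u\<^sub>t|v\<^sub>t\<rangle> = \<langle>u\<^sub>s|v\<^sub>s\<rangle>\<langle>w|w'\<rangle>\<close> for \<open>s \<le> t\<close>, \<open>u\<^sub>t = u\<^sub>s w\<close> and \<open>v\<^sub>t = v\<^sub>s w'\<close>, a zero persists to the right, and a nonzero value is nonzero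
  nearby by continuity up to scalars. The remaining point is that a zero at \<open>t\<close> is not new: as
  \<open>s\<close> increases to \<open>t\<close>, \<open>u\<^sub>s w \<zeta> = u\<^sub>t \<zeta>\<close> is close to a multiple of \<open>u\<^sub>s \<zeta>\<close>, so \<open>w \<zeta>\<close> is close to a multiple
  of \<open>\<zeta>\<close> because \<open>u\<^sub>s\<close> is isometric. The same holds for \<open>w' \<zeta>\<close>, whence \<open>\<langle>w|w'\<rangle> \<noteq> 0\<close>.\<close>

lemma ps_inner_nonzero_unit:
  assumes u: "unit_left_coherent P \<alpha> u" and v: "unit_left_coherent P \<alpha> v" and x: "x \<in> P"
  shows "ps_inner (u x) (v x) \<noteq> 0"
proof -
  note cu = unit_left_coherent_left_coherent[OF u] and cv = unit_left_coherent_left_coherent[OF v]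
  have nu: "norm (u y \<xi>) = norm \<xi>" and nv: "norm (v y \<xi>) = norm \<xi>" if "y \<in> P" for y \<xi>
    using that u v norm_E(1) left_coherent_E[OF cu] left_coherent_E[OF cv]
    by (simp_all add: unit_left_coherent_def)
  obtain \<zeta> :: 'h where \<zeta>: "norm \<zeta> = 1"
  proof -
    obtain \<zeta> :: 'h where "\<zeta> \<noteq> 0" using nontrivial by blast
    then show thesis by (intro that[of "(1 / norm \<zeta>) *\<^sub>R \<zeta>"]) simp
  qed
  define N where "N s \<longleftrightarrow> ps_inner (u (s *\<^sub>R x)) (v (s *\<^sub>R x)) \<noteq> 0" for s
  have inP: "s *\<^sub>R x \<in> P" if "s \<ge> 0" for s using x that by (simp add: scaleR_in_P)
  have factor: "\<exists>w\<in>E ((t - s) *\<^sub>R x). \<exists>w'\<in>E ((t - s) *\<^sub>R x).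
      u (t *\<^sub>R x) = u (s *\<^sub>R x) o\<^sub>L w \<and> v (t *\<^sub>R x) = v (s *\<^sub>R x) o\<^sub>L w'"
    if "0 \<le> s" "s \<le> t" for s t
    using that left_coherent_factor[OF cu, of "t *\<^sub>R x" "s *\<^sub>R x"]
      left_coherent_factor[OF cv, of "t *\<^sub>R x" "s *\<^sub>R x"] inP D_E
    by (simp add: scaleR_diff_left[symmetric]) metis
  have N_split: "ps_inner (u (t *\<^sub>R x)) (v (t *\<^sub>R x)) = ps_inner (u (s *\<^sub>R x)) (v (s *\<^sub>R x)) * ps_inner w w'"
    if "0 \<le> s" "s \<le> t" "w \<in> E ((t - s) *\<^sub>R x)" "w' \<in> E ((t - s) *\<^sub>R x)"
      "u (t *\<^sub>R x) = u (s *\<^sub>R x) o\<^sub>L w" "v (t *\<^sub>R x) = v (s *\<^sub>R x) o\<^sub>L w'" for s t w w'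
    unfolding that(5,6)
    using that inP by (intro ps_inner_compose[of "s *\<^sub>R x" "(t - s) *\<^sub>R x"])
      (auto intro: left_coherent_E[OF cu] left_coherent_E[OF cv])
  have N_mono: "N s" if "0 \<le> s" "s \<le> t" "N t" for s t
    using factor[OF that(1,2)] N_split[OF that(1,2)] that(3) by (auto simp: N_def)
  have "N 0 = N 1"
  proof (rule connected_local_const[of "{0..1::real}"])
    show "\<forall>t\<in>{0..1}. \<forall>\<^sub>F s in at t within {0..1}. N t = N s"
    proof
      fix t :: real assume t: "t \<in> {0..1}"
      let ?F = "at t within {0..1::real}"
      obtain c where c: "c (t *\<^sub>R x) = 1" "\<And>\<zeta>. continuous (at (t *\<^sub>R x) within P) (\<lambda>y. c y *\<^sub>C u y \<zeta>)"
        using continuous_up_to_scalars[OF cu inP] t by auto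
      obtain d where d: "d (t *\<^sub>R x) = 1" "\<And>\<zeta>. continuous (at (t *\<^sub>R x) within P) (\<lambda>y. d y *\<^sub>C v y \<zeta>)"
        using continuous_up_to_scalars[OF cv inP] t by auto
      have sub: "(\<lambda>s. s *\<^sub>R x) ` {0..1} \<subseteq> P" using inP by auto
      have lim: "((\<lambda>s. f (s *\<^sub>R x)) \<longlongrightarrow> f (t *\<^sub>R x)) ?F"
        if "continuous (at (t *\<^sub>R x) within P) f" for f :: "_ \<Rightarrow> 'h"
        using continuous_within_compose2[of t "{0..1}" "\<lambda>s. s *\<^sub>R x" f]
          continuous_within_subset[OF that sub]
        by (simp add: continuous_within tendsto_intros)
      have limu: "((\<lambda>s. c (s *\<^sub>R x) *\<^sub>C u (s *\<^sub>R x) \<zeta>) \<longlongrightarrow> u (t *\<^sub>R x) \<zeta>) ?F"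
        using lim[OF c(2)] c(1) by (simp add: scaleC_one)
      have limv: "((\<lambda>s. d (s *\<^sub>R x) *\<^sub>C v (s *\<^sub>R x) \<zeta>) \<longlongrightarrow> v (t *\<^sub>R x) \<zeta>) ?F"
        using lim[OF d(2)] d(1) by (simp add: scaleC_one)
      have inI: "\<forall>\<^sub>F s in ?F. s \<in> {0..1}" by (simp add: eventually_at_filter)
      have cuv: "cinner (u (s *\<^sub>R x) \<zeta>) (v (s *\<^sub>R x) \<zeta>) = ps_inner (u (s *\<^sub>R x)) (v (s *\<^sub>R x))" if "s \<in> {0..1}" for s
        using cinner_E[OF inP left_coherent_E[OF cu inP] left_coherent_E[OF cv inP], of s \<zeta> \<zeta>] that
        by (simp add: cinner_self \<zeta>)
      show "\<forall>\<^sub>F s in ?F. N t = N s"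
      proof (cases "N t")
        case True
        then have "cinner (u (t *\<^sub>R x) \<zeta>) (v (t *\<^sub>R x) \<zeta>) \<noteq> 0"
          using cuv[OF t] by (simp add: N_def)
        then have "\<forall>\<^sub>F s in ?F. cinner (c (s *\<^sub>R x) *\<^sub>C u (s *\<^sub>R x) \<zeta>) (d (s *\<^sub>R x) *\<^sub>C v (s *\<^sub>R x) \<zeta>) \<noteq> 0"
          using tendsto_imp_eventually_ne[OF tendsto_cinner[OF limu limv]] by blast
        with inI show ?thesis
          by eventually_elim (use True in \<open>auto simp: N_def cinner_scaleC_left cinner_scaleC_right cuv\<close>)
      next
        case False
        have "\<forall>\<^sub>F s in ?F. dist (c (s *\<^sub>R x) *\<^sub>C u (s *\<^sub>R x) \<zeta>) (u (t *\<^sub>R x) \<zeta>) < 1/4"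
          "\<forall>\<^sub>F s in ?F. dist (d (s *\<^sub>R x) *\<^sub>C v (s *\<^sub>R x) \<zeta>) (v (t *\<^sub>R x) \<zeta>) < 1/4"
          by (rule tendstoD[OF limu] tendstoD[OF limv], simp)+
        with inI have "\<forall>\<^sub>F s in ?F. \<not> N s"
        proof eventually_elim
          case (elim s)
          show ?case
          proof (cases "s \<le> t")
            case False
            then show ?thesis using N_mono[of t s] \<open>\<not> N t\<close> t by auto
          next
            case True
            have s0: "0 \<le> s" using elim by simp
            obtain w w' where w: "w \<in> E ((t - s) *\<^sub>R x)" "w' \<in> E ((t - s) *\<^sub>R x)"
              "u (t *\<^sub>R x) = u (s *\<^sub>R x) o\<^sub>L w" "v (t *\<^sub>R x) = v (s *\<^sub>R x) o\<^sub>L w'"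
              using factor[OF s0 True] by metis
            note BHu = product_system_BH[OF left_coherent_E[OF cu inP[OF s0]]]
              and BHv = product_system_BH[OF left_coherent_E[OF cv inP[OF s0]]]
            have t0: "t \<ge> 0" using t by simp
            have "norm (w \<zeta>) = 1" "norm (w' \<zeta>) = 1"
              using nu[OF inP[OF s0], of "w \<zeta>"] nu[OF inP[OF t0], of \<zeta>] w(3)
                nv[OF inP[OF s0], of "w' \<zeta>"] nv[OF inP[OF t0], of \<zeta>] w(4) \<zeta> by simp_all
            moreover have "norm (c (s *\<^sub>R x) *\<^sub>C \<zeta> - w \<zeta>) < 1/4"
              using elim(2) nu[OF inP[OF s0], of "c (s *\<^sub>R x) *\<^sub>C \<zeta> - w \<zeta>"]
              by (simp add: dist_norm w(3) blinfun.diff_right BH_scaleC[OF BHu])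
            moreover have "norm (d (s *\<^sub>R x) *\<^sub>C \<zeta> - w' \<zeta>) < 1/4"
              using elim(3) nv[OF inP[OF s0], of "d (s *\<^sub>R x) *\<^sub>C \<zeta> - w' \<zeta>"]
              by (simp add: dist_norm w(4) blinfun.diff_right BH_scaleC[OF BHv])
            ultimately have "cinner (w \<zeta>) (w' \<zeta>) \<noteq> 0"
              using cinner_nonzero_of_near_common_direction[OF \<zeta>] by blast
            then have "ps_inner w w' \<noteq> 0"
              using cinner_E[OF inP w(1,2), of \<zeta> \<zeta>] True by auto
            then show ?thesis
              using N_split[OF s0 True w] \<open>\<not> N t\<close> by (auto simp: N_def)
          qed
        qed
        then show ?thesis using False by simp
      qed
    qed
  qed auto
  moreover have "N 0"
    using left_coherentD[OF cu] left_coherentD[OF cv] by (simp add: N_def E_zero_inner)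
  ultimately show ?thesis by (simp add: N_def)
qed

lemma ps_inner_left_coherent_nonzero:
  assumes u: "left_coherent P \<alpha> u" and v: "left_coherent P \<alpha> v" and x: "x \<in> P"
  shows "ps_inner (u x) (v x) \<noteq> 0"
proof -
  have "ps_inner (complex_of_real (1 / ps_norm (u x)) *\<^sub>C u x)
      (complex_of_real (1 / ps_norm (v x)) *\<^sub>C v x) \<noteq> 0"
    by (rule ps_inner_nonzero_unit[OF unit_left_coherent_normalize[OF u] unit_left_coherent_normalize[OF v] x])
  then show ?thesis
    using x left_coherent_E[OF u x] left_coherent_E[OF v x]
    by (auto simp: ps_inner_scaleC_left ps_inner_scaleC_right E_scaleC simp del: of_real_divide)
qed

lemma ray_left_coherent_unique:
  assumes u: "left_coherent P \<alpha> u" and v: "left_coherent P \<alpha> v"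
    and P: "x \<in> P" "y \<in> P" "x - y \<in> P" and eq: "ray (u x) = ray (v x)"
  shows "ray (u y) = ray (v y)"
proof -
  obtain w where w: "w \<in> D (x - y)" "u x = u y o\<^sub>L w" using left_coherent_factor[OF u P] by blast
  obtain w' where w': "w' \<in> D (x - y)" "v x = v y o\<^sub>L w'" using left_coherent_factor[OF v P] by blast
  obtain c where c: "c \<noteq> 0" "u x = c *\<^sub>C v x" using ray_eqD[OF eq] by blast
  have BH: "v y \<in> BH" using left_coherent_E[OF v P(2)] by (rule product_system_BH)
  have "v y o\<^sub>L (c *\<^sub>C w') = u y o\<^sub>L w"
    using c w w' BH by (simp add: scaleC_compose_right)
  moreover have "u y \<in> E (y + 0)" using left_coherent_E[OF u P(2)] by simp
  ultimately obtain t where t: "t \<in> E 0" "u y = v y o\<^sub>L t"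
    using left_factor_unique[OF P(2) zero_in_P P(3) left_coherent_E[OF v P(2)]
        left_coherent_nonzero[OF v P(2)] _ D_E[OF w(1)] D_nonzero[OF w(1)]] by metis
  obtain k where k: "t = k *\<^sub>C id_blinfun" using E_zero[OF t(1)] by blast
  have "u y = k *\<^sub>C v y"
    using t(2) k BH by (intro blinfun_eqI) (simp add: BH_scaleC)
  moreover have "k \<noteq> 0"
    using calculation left_coherent_nonzero[OF u P(2)] by auto
  ultimately show ?thesis by (simp add: ray_scaleC)
qed

lemma interior_cofinal:
  assumes x: "x \<in> interior P"
  shows "\<exists>n. real (Suc n) *\<^sub>R x - y \<in> P"
proof -
  have "(\<lambda>n. x - (1 / real (Suc n)) *\<^sub>R y) \<longlonglongrightarrow> x - 0 *\<^sub>R y"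
    using LIMSEQ_inverse_real_of_nat by (intro tendsto_intros) (simp add: inverse_eq_divide)
  then have "\<forall>\<^sub>F n in sequentially. x - (1 / real (Suc n)) *\<^sub>R y \<in> interior P"
    using topological_tendstoD[OF _ open_interior, of _ x] x by simp
  then obtain n where "x - (1 / real (Suc n)) *\<^sub>R y \<in> P"
    using eventually_happens'[OF sequentially_bot] interior_subset by blast
  then have "real (Suc n) *\<^sub>R (x - (1 / real (Suc n)) *\<^sub>R y) \<in> P"
    by (intro scaleR_in_P) simp_all
  then show ?thesis
    by (intro exI[of _ n]) (simp add: scaleR_diff_right)
qed

text \<open>The points \<open>n x\<close> are cofinal in \<open>P\<close> when \<open>x\<close> is interior, and all powers \<open>u\<^sup>n\<close> are decomposable.
  A section through \<open>u\<close> is obtained by choosing at each \<open>y\<close> some left factor over \<open>y\<close> of some power;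
  any two such choices are comparable, since powers of \<open>u\<close> commute. The scalars may be chosen
  arbitrarily, because left coherence is insensitive to pointwise rescaling.\<close>

lemma left_coherent_through:
  assumes x: "x \<in> interior P" and u: "u \<in> D x"
  obtains s where "left_coherent P \<alpha> s" "ray (s x) = ray u"
proof -
  note xP = interior_subset_P[OF x]
  \<comment> \<open>\<open>U n\<close> is the power with \<open>n + 1\<close> factors, so that no identity of \<open>E(0)\<close> is involved.\<close>
  define U where "U n = ((\<lambda>v. v o\<^sub>L u) ^^ n) u" for n
  have U_Suc: "U (Suc n) = U n o\<^sub>L u" for n by (simp add: U_def)
  have U_D: "U n \<in> D (real (Suc n) *\<^sub>R x)" for n
  proof (induction n)
    case 0
    then show ?case using u by (simp add: U_def)
  next
    case (Suc n)
    have "U n o\<^sub>L u \<in> D (real (Suc n) *\<^sub>R x + x)"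
      by (intro D_compose Suc u xP scaleR_in_P) simp
    moreover have "real (Suc (Suc n)) *\<^sub>R x = real (Suc n) *\<^sub>R x + x"
      by (simp add: scaleR_add_left algebra_simps scaleR_2)
    ultimately show ?case by (simp only: U_Suc)
  qed
  have U_add: "U (Suc (n + m)) = U n o\<^sub>L U m" for n m
  proof (induction m)
    case (Suc m)
    then show ?case by (metis U_Suc add_Suc_right blinfun_compose_assoc)
  qed (simp add: U_def)
  define is_prefix where "is_prefix y a \<longleftrightarrow> a \<in> E y \<and> (\<exists>n b. real (Suc n) *\<^sub>R x - y \<in> P \<and>
    b \<in> E (real (Suc n) *\<^sub>R x - y) \<and> U n = a o\<^sub>L b)" for y a
  have ex: "\<exists>a. is_prefix y a" if y: "y \<in> P" for y
  proof -
    obtain n where n: "real (Suc n) *\<^sub>R x - y \<in> P" using interior_cofinal[OF x] by blast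
    then show ?thesis
      using D_factor[OF U_D y n] unfolding is_prefix_def by metis
  qed
  have prefix_D: "a \<in> D y" if "is_prefix y a" "y \<in> P" for y a
    using that left_factor_in_D[OF U_D] unfolding is_prefix_def by blast
  have prefix_factor: "\<exists>t\<in>E (z - y). a' = a o\<^sub>L t"
    if a: "is_prefix y a" and a': "is_prefix z a'" and P: "y \<in> P" "z \<in> P" "z - y \<in> P" for y z a a'
  proof -
    obtain n b where b: "U n = a o\<^sub>L b" using a by (auto simp: is_prefix_def)
    obtain m b' where m: "real (Suc m) *\<^sub>R x - z \<in> P" "b' \<in> E (real (Suc m) *\<^sub>R x - z)" "U m = a' o\<^sub>L b'"
      using a' by (auto simp: is_prefix_def)
    \<comment> \<open>Both are left factors of the power \<open>U n o\<^sub>L U m = U m o\<^sub>L U n\<close>.\<close>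
    have eq: "a o\<^sub>L (b o\<^sub>L U m) = a' o\<^sub>L (b' o\<^sub>L U n)"
      using U_add[of n m] U_add[of m n] by (simp add: b m(3) add.commute blinfun_compose_assoc)
    have nP: "real (Suc n) *\<^sub>R x \<in> P" by (intro scaleR_in_P xP) simp
    have "b' \<noteq> 0"
      using m(3) D_nonzero[OF U_D[of m]] by auto
    then have nz: "b' o\<^sub>L U n \<noteq> 0"
      by (rule E_compose_nonzero[OF m(1) nP m(2) D_E[OF U_D] _ D_nonzero[OF U_D]])
    have aE: "a \<in> E y" and aE': "a' \<in> E (y + (z - y))"
      using a a' by (simp_all add: is_prefix_def)
    have "a \<noteq> 0" using prefix_D[OF a P(1)] by (rule D_nonzero)
    from left_factor_unique[OF P(1,3) add_in_P[OF m(1) nP] aE this aE'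
        E_compose[OF m(1) nP m(2) D_E[OF U_D]] nz eq]
    show ?thesis by blast
  qed
  define s where "s y = (SOME a. is_prefix y a)" for y
  have s: "is_prefix y (s y)" if "y \<in> P" for y
    unfolding s_def using ex[OF that] by (rule someI_ex)
  have coh: "left_coherent P \<alpha> s"
    unfolding left_coherent_def
  proof (intro conjI ballI impI)
    show sD: "s y \<in> D y" if "y \<in> P" for y using prefix_D s that by blast
    fix z y assume P: "z \<in> P" "y \<in> P" "cone_le P y z"
    then have "z - y \<in> P" by (simp add: cone_le_def)
    then obtain t where "t \<in> E (z - y)" "s z = s y o\<^sub>L t"
      using prefix_factor s P by metis
    then show "\<exists>w\<in>D (z - y). s z = s y o\<^sub>L w"
      using right_factor_in_D[OF sD[OF P(1)] _ D_E[OF sD[OF P(2)]]] P \<open>z - y \<in> P\<close> by blast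
  qed
  have "real (Suc 1) *\<^sub>R x - x = x" by (simp add: scaleR_2)
  then have "is_prefix x u"
    unfolding is_prefix_def
    using D_E[OF u] xP by (intro conjI exI[of _ "1::nat"] exI[of _ u]) (simp_all add: U_def)
  then obtain t where t: "t \<in> E 0" "s x = u o\<^sub>L t"
    using prefix_factor[OF _ s[OF xP] xP xP] by auto
  obtain k where k: "t = k *\<^sub>C id_blinfun" using E_zero[OF t(1)] by blast
  have "s x = k *\<^sub>C u"
    using t(2) k product_system_BH[OF D_E[OF u]] by (intro blinfun_eqI) (simp add: BH_scaleC)
  moreover have "k \<noteq> 0"
    using calculation left_coherent_nonzero[OF coh xP] by auto
  ultimately show ?thesis
    using that coh by (simp add: ray_scaleC)
qed

end

section \<open>Continuous logarithms on connected sets\<close>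

lemma complex_exp_eq_near:
  assumes "exp w = exp z" "norm (w - z) < 1"
  shows "w = (z::complex)"
proof (rule exp_complex_eqI[OF _ assms(1)])
  have "\<bar>Im (w - z)\<bar> < 1" using abs_Im_le_cmod[of "w - z"] assms(2) by linarith
  then show "\<bar>Im w - Im z\<bar> < 2 * pi" using pi_gt3 by simp
qed

text \<open>The difference of the logarithms is continuous with values in \<open>2\<pi>i\<int>\<close>.\<close>

lemma continuous_logs_agree:
  fixes f g :: "'a::topological_space \<Rightarrow> complex"
  assumes S: "connected S" and cont: "continuous_on S f" "continuous_on S g"
    and eq: "\<And>x. x \<in> S \<Longrightarrow> exp (f x) = exp (g x)"
    and a: "a \<in> S" "f a = g a" and x: "x \<in> S"
  shows "f x = g x"
proof -
  have "\<exists>e>0. \<forall>z. z \<in> S \<and> f z - g z \<noteq> f y - g y \<longrightarrow> e \<le> norm ((f z - g z) - (f y - g y))" if y: "y \<in> S" for y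
  proof (intro exI[of _ 1] conjI allI impI)
    fix z assume z: "z \<in> S \<and> f z - g z \<noteq> f y - g y"
    then have "exp (f z - g z) = exp (f y - g y)"
      using y eq by (simp add: exp_diff)
    then show "1 \<le> norm ((f z - g z) - (f y - g y))"
      using complex_exp_eq_near[of "f z - g z" "f y - g y"] z by (metis not_le)
  qed simp
  then have "(\<lambda>x. f x - g x) constant_on S"
    by (intro continuous_discrete_range_constant S continuous_on_diff cont)
  then obtain k where "\<forall>y\<in>S. f y - g y = k" by (auto simp: constant_on_def)
  then have "f x - g x = f a - g a" using a(1) x by metis
  then show ?thesis using a(2) by simp
qed

context decomposable_semigroup
begin

section \<open>The covariance along sections\<close>

definition covariance :: "('h \<Rightarrow>\<^sub>L 'h) \<Rightarrow> ('h \<Rightarrow>\<^sub>L 'h) \<Rightarrow> ('h \<Rightarrow>\<^sub>L 'h) \<Rightarrow> complex" where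
  "covariance e u v = ps_inner u v / (ps_inner u e * ps_inner e v)"

lemma covariance_ray:
  assumes x: "x \<in> P" and E: "e \<in> E x" "u \<in> E x" "v \<in> E x" "u' \<in> E x" "v' \<in> E x"
    and eq: "ray u = ray u'" "ray v = ray v'"
  shows "covariance e u v = covariance e u' v'"
proof -
  obtain a b where "a \<noteq> 0" "u = a *\<^sub>C u'" "b \<noteq> 0" "v = b *\<^sub>C v'"
    using ray_eqD[OF eq(1)] ray_eqD[OF eq(2)] by blast
  then show ?thesis
    using x E by (simp add: covariance_def ps_inner_scaleC_left ps_inner_scaleC_right E_scaleC)
qed

lemma ps_inner_unit:
  assumes "unit_left_coherent P \<alpha> e" "x \<in> P"
  shows "ps_inner (e x) (e x) = 1"
  using ps_inner_self[OF assms(2) left_coherent_E[OF unit_left_coherent_left_coherent[OF assms(1)] assms(2)]] assms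
  by (simp add: unit_left_coherent_def)

lemma covariance_nonzero:
  assumes "unit_left_coherent P \<alpha> e" "left_coherent P \<alpha> u" "left_coherent P \<alpha> v" "x \<in> P"
  shows "covariance (e x) (u x) (v x) \<noteq> 0"
  using ps_inner_left_coherent_nonzero assms unit_left_coherent_left_coherent
  by (simp add: covariance_def)

lemma covariance_zero:
  assumes e: "unit_left_coherent P \<alpha> e" and u: "left_coherent P \<alpha> u" and v: "left_coherent P \<alpha> v"
  shows "covariance (e 0) (u 0) (v 0) = 1"
proof -
  note E = left_coherent_E[OF unit_left_coherent_left_coherent[OF e] zero_in_P]
    left_coherent_E[OF u zero_in_P] left_coherent_E[OF v zero_in_P]
  obtain a b c where abc: "u 0 = a *\<^sub>C id_blinfun" "v 0 = b *\<^sub>C id_blinfun" "e 0 = c *\<^sub>C id_blinfun"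
    using E_zero E by metis
  have ip: "ps_inner (p *\<^sub>C id_blinfun :: 'h \<Rightarrow>\<^sub>L 'h) (q *\<^sub>C id_blinfun) = p * cnj q"
    if "p *\<^sub>C id_blinfun \<in> E 0" "q *\<^sub>C id_blinfun \<in> E 0" for p q
    using that by (intro ps_inner_eqI[of 0]) (simp_all add: cinner_scaleC_left cinner_scaleC_right)
  have "c * cnj c = 1"
    using ps_inner_unit[OF e zero_in_P] ip[of c c] E abc by simp
  moreover have "a \<noteq> 0" "b \<noteq> 0"
    using left_coherent_nonzero[OF u zero_in_P] left_coherent_nonzero[OF v zero_in_P] abc by auto
  ultimately show ?thesis
    using E by (simp add: covariance_def abc ip field_simps)
qed

text \<open>Once \<open>\<langle>e\<^sub>y|e\<^sub>y\<rangle> = 1\<close> is inserted into the numerator, the quotient is unchanged when \<open>u\<^sub>y\<close>, \<open>v\<^sub>y\<close> and \<open>e\<^sub>y\<close>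
  are rescaled, so they may be replaced by representatives that are continuous at \<open>x\<close>.\<close>

lemma continuous_on_covariance:
  assumes e: "unit_left_coherent P \<alpha> e" and u: "left_coherent P \<alpha> u" and v: "left_coherent P \<alpha> v"
  shows "continuous_on P (\<lambda>x. covariance (e x) (u x) (v x))"
  unfolding continuous_on_def
proof
  fix x assume x: "x \<in> P"
  note ce = unit_left_coherent_left_coherent[OF e]
  obtain \<zeta> :: 'h where \<zeta>: "\<zeta> \<noteq> 0" using nontrivial by blast
  have ip: "cinner (S \<zeta>) (T \<zeta>) = ps_inner S T * cinner \<zeta> \<zeta>" if "y \<in> P" "S \<in> E y" "T \<in> E y" for y S T
    using cinner_E[OF that] .
  let ?F = "at x within P"
  have rep: "\<exists>s. ((\<lambda>y. s y *\<^sub>C w y \<zeta>) \<longlongrightarrow> w x \<zeta>) ?F \<and> (\<forall>\<^sub>F y in ?F. s y \<noteq> 0)" if w: "left_coherent P \<alpha> w" for w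
  proof -
    obtain s where s: "s x = 1" "\<And>\<zeta>. continuous (at x within P) (\<lambda>y. s y *\<^sub>C w y \<zeta>)"
      using continuous_up_to_scalars[OF w x] by blast
    have lim: "((\<lambda>y. s y *\<^sub>C w y \<zeta>) \<longlongrightarrow> w x \<zeta>) ?F"
      using s(2)[of \<zeta>] s(1) by (simp add: continuous_within scaleC_one)
    have "w x \<zeta> \<noteq> 0"
      using E_injective[OF x left_coherent_E[OF w x] left_coherent_nonzero[OF w x]] \<zeta> by blast
    then have "\<forall>\<^sub>F y in ?F. s y *\<^sub>C w y \<zeta> \<noteq> 0"
      by (rule tendsto_imp_eventually_ne[OF lim])
    then show ?thesis using lim by (auto elim: eventually_mono)
  qed
  obtain a where a: "((\<lambda>y. a y *\<^sub>C u y \<zeta>) \<longlongrightarrow> u x \<zeta>) ?F" "\<forall>\<^sub>F y in ?F. a y \<noteq> 0" using rep[OF u] by blast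
  obtain b where b: "((\<lambda>y. b y *\<^sub>C v y \<zeta>) \<longlongrightarrow> v x \<zeta>) ?F" "\<forall>\<^sub>F y in ?F. b y \<noteq> 0" using rep[OF v] by blast
  obtain c where c: "((\<lambda>y. c y *\<^sub>C e y \<zeta>) \<longlongrightarrow> e x \<zeta>) ?F" "\<forall>\<^sub>F y in ?F. c y \<noteq> 0" using rep[OF ce] by blast
  \<comment> \<open>Unchanged under rescaling of any of its three arguments.\<close>
  define ratio where "ratio p q r = cinner p q * cinner r r / (cinner p r * cinner r q)" for p q r :: 'h
  have ratio_scaleC: "ratio (k *\<^sub>C p) (l *\<^sub>C q) (m *\<^sub>C r) = ratio p q r"
    if "k \<noteq> 0" "l \<noteq> 0" "m \<noteq> 0" for k l m p q r
    using that by (simp add: ratio_def cinner_scaleC_left cinner_scaleC_right field_simps)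
  have ratio_covariance: "ratio (u y \<zeta>) (v y \<zeta>) (e y \<zeta>) = covariance (e y) (u y) (v y)" if y: "y \<in> P" for y
    using \<zeta> by (simp add: ratio_def covariance_def ps_inner_unit[OF e y]
        ip[OF y] left_coherent_E[OF u y] left_coherent_E[OF v y] left_coherent_E[OF ce y])
  have "cinner (u x \<zeta>) (e x \<zeta>) \<noteq> 0" "cinner (e x \<zeta>) (v x \<zeta>) \<noteq> 0"
    using \<zeta> x ps_inner_left_coherent_nonzero[OF u ce x] ps_inner_left_coherent_nonzero[OF ce v x]
    by (simp_all add: ip[OF x] left_coherent_E[OF u x] left_coherent_E[OF v x] left_coherent_E[OF ce x])
  then have "((\<lambda>y. ratio (a y *\<^sub>C u y \<zeta>) (b y *\<^sub>C v y \<zeta>) (c y *\<^sub>C e y \<zeta>)) \<longlongrightarrow> ratio (u x \<zeta>) (v x \<zeta>) (e x \<zeta>)) ?F"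
    unfolding ratio_def by (intro tendsto_intros a b c) simp
  moreover have "\<forall>\<^sub>F y in ?F. y \<in> P" by (simp add: eventually_at_filter)
  then have "\<forall>\<^sub>F y in ?F. ratio (a y *\<^sub>C u y \<zeta>) (b y *\<^sub>C v y \<zeta>) (c y *\<^sub>C e y \<zeta>) = covariance (e y) (u y) (v y)"
    using a(2) b(2) c(2) by eventually_elim (simp add: ratio_scaleC ratio_covariance)
  ultimately have "((\<lambda>y. covariance (e y) (u y) (v y)) \<longlongrightarrow> ratio (u x \<zeta>) (v x \<zeta>) (e x \<zeta>)) ?F"
    by (rule Lim_transform_eventually)
  then show "((\<lambda>y. covariance (e y) (u y) (v y)) \<longlongrightarrow> covariance (e x) (u x) (v x)) ?F"
    by (simp add: ratio_covariance x)
qed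

section \<open>Logarithms of the covariance\<close>

definition is_section_log ::
    "(real^'d \<Rightarrow> 'h \<Rightarrow>\<^sub>L 'h) \<Rightarrow> (real^'d \<Rightarrow> 'h \<Rightarrow>\<^sub>L 'h) \<Rightarrow> (real^'d \<Rightarrow> 'h \<Rightarrow>\<^sub>L 'h) \<Rightarrow>
      (real^'d \<Rightarrow> complex) \<Rightarrow> bool" where
  "is_section_log e u v g \<longleftrightarrow> continuous_on P g \<and> g 0 = 0 \<and>
     (\<forall>x\<in>P. exp (g x) = covariance (e x) (u x) (v x))"

lemma section_log_exists:
  assumes e: "unit_left_coherent P \<alpha> e" and u: "left_coherent P \<alpha> u" and v: "left_coherent P \<alpha> v"
  shows "\<exists>g. is_section_log e u v g"
proof -
  obtain g where g: "continuous_on P g" "\<And>x. x \<in> P \<Longrightarrow> covariance (e x) (u x) (v x) = exp (g x)"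
    using continuous_logarithm_on_contractible[OF continuous_on_covariance[OF e u v]
        convex_imp_contractible[OF convex_P] covariance_nonzero[OF e u v]] by blast
  have "exp (g 0) = 1" using g(2)[OF zero_in_P] covariance_zero[OF e u v] by simp
  then have "is_section_log e u v (\<lambda>x. g x - g 0)"
    using g by (auto simp: is_section_log_def exp_diff intro!: continuous_intros)
  then show ?thesis by (rule exI[of _ "\<lambda>x. g x - g 0"])
qed

text \<open>The rays of a left coherent section at \<open>x\<close> determine its rays at all \<open>y \<le> x\<close>, in particular on
  the segment from \<open>0\<close> to \<open>x\<close>. There both logarithms lift the same function from the common value
  \<open>0\<close> at the origin.\<close>

lemma section_log_depends_on_rays:
  assumes e: "unit_left_coherent P \<alpha> e"
    and coh: "left_coherent P \<alpha> u" "left_coherent P \<alpha> v" "left_coherent P \<alpha> u'" "left_coherent P \<alpha> v'"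
    and g: "is_section_log e u v g" and g': "is_section_log e u' v' g'"
    and x: "x \<in> P" and eq: "ray (u x) = ray (u' x)" "ray (v x) = ray (v' x)"
  shows "g x = g' x"
proof -
  have inP: "s *\<^sub>R x \<in> P" "x - s *\<^sub>R x \<in> P" if "s \<in> {0..1}" for s
    using that scaleR_in_P[OF x, of s] scaleR_in_P[OF x, of "1 - s"] by (simp_all add: scaleR_diff_left)
  have "g (1 *\<^sub>R x) = g' (1 *\<^sub>R x)"
  proof (rule continuous_logs_agree[where S = "{0..1::real}" and a = 0 and f = "\<lambda>s. g (s *\<^sub>R x)"])
    show "continuous_on {0..1} (\<lambda>s. g (s *\<^sub>R x))" "continuous_on {0..1} (\<lambda>s. g' (s *\<^sub>R x))"
      using g g' inP unfolding is_section_log_def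
      by (auto intro!: continuous_on_compose2[of P _ "{0..1}" "\<lambda>s. s *\<^sub>R x"] continuous_intros)
    show "exp (g (s *\<^sub>R x)) = exp (g' (s *\<^sub>R x))" if s: "s \<in> {0..1}" for s
    proof -
      note y = inP[OF s]
      have "ray (u (s *\<^sub>R x)) = ray (u' (s *\<^sub>R x))" "ray (v (s *\<^sub>R x)) = ray (v' (s *\<^sub>R x))"
        using ray_left_coherent_unique[OF coh(1,3) x y eq(1)]
          ray_left_coherent_unique[OF coh(2,4) x y eq(2)] by simp_all
      then have "covariance (e (s *\<^sub>R x)) (u (s *\<^sub>R x)) (v (s *\<^sub>R x))
          = covariance (e (s *\<^sub>R x)) (u' (s *\<^sub>R x)) (v' (s *\<^sub>R x))"
        by (intro covariance_ray[OF y(1)] left_coherent_E[OF _ y(1)] coh unit_left_coherent_left_coherent[OF e])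
      then show ?thesis using g g' y(1) by (simp add: is_section_log_def)
    qed
  qed (use g g' in \<open>auto simp: is_section_log_def\<close>)
  then show ?thesis by simp
qed

lemma Delta2_left_coherent:
  "left_coherent P \<alpha> u \<Longrightarrow> left_coherent P \<alpha> v \<Longrightarrow> x \<in> interior P \<Longrightarrow> (x, ray (u x), ray (v x)) \<in> Delta2 P \<alpha>"
  unfolding Delta2_def using left_coherent_D interior_subset_P by blast

text \<open>It suffices to check the defining equation along left coherent sections, since they pass through
  every decomposable vector over an interior point.\<close>

lemma is_covariance_logI:
  assumes cont: "\<And>u v. left_coherent P \<alpha> u \<Longrightarrow> left_coherent P \<alpha> v \<Longrightarrow>
      continuous_on (interior P) (\<lambda>x. L (x, ray (u x), ray (v x)))"
    and lim: "\<And>u v. left_coherent P \<alpha> u \<Longrightarrow> left_coherent P \<alpha> v \<Longrightarrow>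
      ((\<lambda>x. L (x, ray (u x), ray (v x))) \<longlongrightarrow> 0) (at 0 within interior P)"
    and exp: "\<And>u v x. left_coherent P \<alpha> u \<Longrightarrow> left_coherent P \<alpha> v \<Longrightarrow> x \<in> interior P \<Longrightarrow>
      exp (L (x, ray (u x), ray (v x))) = covariance (e x) (u x) (v x)"
    and e: "left_coherent P \<alpha> e"
  shows "is_covariance_log P \<alpha> e (restrict L (Delta2 P \<alpha>))"
  unfolding is_covariance_log_def
proof (intro conjI ballI)
  show "Delta2_continuous P \<alpha> (restrict L (Delta2 P \<alpha>))"
    unfolding Delta2_continuous_def
  proof (intro allI impI)
    fix u v assume uv: "left_coherent P \<alpha> u" "left_coherent P \<alpha> v"
    show "continuous_on (interior P) (\<lambda>x. restrict L (Delta2 P \<alpha>) (x, ray (u x), ray (v x)))"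
      by (rule continuous_on_eq[OF cont[OF uv]]) (simp add: Delta2_left_coherent[OF uv])
  qed
  show "Delta2_vanishes_at_origin P \<alpha> (restrict L (Delta2 P \<alpha>))"
    unfolding Delta2_vanishes_at_origin_def
  proof (intro allI impI)
    fix u v assume uv: "left_coherent P \<alpha> u" "left_coherent P \<alpha> v"
    show "((\<lambda>x. restrict L (Delta2 P \<alpha>) (x, ray (u x), ray (v x))) \<longlongrightarrow> 0) (at 0 within interior P)"
      by (rule Lim_transform_eventually[OF lim[OF uv]])
        (simp add: eventually_at_filter Delta2_left_coherent[OF uv])
  qed
  fix x u v assume x: "x \<in> interior P" and u: "u \<in> D x" and v: "v \<in> D x"
  obtain s where s: "left_coherent P \<alpha> s" "ray (s x) = ray u" using left_coherent_through[OF x u] .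
  obtain t where t: "left_coherent P \<alpha> t" "ray (t x) = ray v" using left_coherent_through[OF x v] .
  note xP = interior_subset_P[OF x]
  have "exp (restrict L (Delta2 P \<alpha>) (x, ray u, ray v)) = covariance (e x) (s x) (t x)"
    using exp[OF s(1) t(1) x] Delta2_left_coherent[OF s(1) t(1) x] by (simp add: s t)
  also have "\<dots> = covariance (e x) u v"
    by (rule covariance_ray[OF xP left_coherent_E[OF e xP] left_coherent_E[OF s(1) xP]
          left_coherent_E[OF t(1) xP] D_E[OF u] D_E[OF v] s(2) t(2)])
  finally show "exp (restrict L (Delta2 P \<alpha>) (x, ray u, ray v)) = ps_inner u v / (ps_inner u (e x) * ps_inner (e x) v)"
    by (simp add: covariance_def)
qed simp

lemma is_covariance_logD:
  assumes "is_covariance_log P \<alpha> e L"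
  shows "left_coherent P \<alpha> u \<Longrightarrow> left_coherent P \<alpha> v \<Longrightarrow>
      continuous_on (interior P) (\<lambda>x. L (x, ray (u x), ray (v x)))"
    and "left_coherent P \<alpha> u \<Longrightarrow> left_coherent P \<alpha> v \<Longrightarrow>
      ((\<lambda>x. L (x, ray (u x), ray (v x))) \<longlongrightarrow> 0) (at 0 within interior P)"
    and "x \<in> interior P \<Longrightarrow> S \<in> D x \<Longrightarrow> T \<in> D x \<Longrightarrow> exp (L (x, ray S, ray T)) = covariance (e x) S T"
  using assms
  by (simp_all add: is_covariance_log_def Delta2_continuous_def Delta2_vanishes_at_origin_def covariance_def)

lemma at_zero_within_interior_nontrivial: "at 0 within interior P \<noteq> bot"
proof -
  have "0 islimpt interior P"
  proof (cases "0 \<in> interior P")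
    case True
    then show ?thesis using interior_limit_point[of 0 "interior P"] by simp
  next
    case False
    have "0 \<in> closure (interior P)"
      using convex_closure_interior[OF convex_P interior_P_nonempty] closure_subset[of P] by auto
    then show ?thesis using False by (simp add: islimpt_in_closure)
  qed
  then show ?thesis by (simp add: trivial_limit_within)
qed

text \<open>Along a pair of sections through given rays, two candidates are logarithms of one function on
  the connected interior of \<open>P\<close>. Both tend to \<open>0\<close> at the origin, so they are closer than \<open>1\<close> and hence
  equal at some interior point, and therefore everywhere.\<close>

lemma covariance_log_unique:
  assumes L: "is_covariance_log P \<alpha> e L" and L': "is_covariance_log P \<alpha> e L'"
  shows "L = L'"
proof (rule PiE_ext)
  show "L \<in> Delta2 P \<alpha> \<rightarrow>\<^sub>E UNIV" "L' \<in> Delta2 P \<alpha> \<rightarrow>\<^sub>E UNIV"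
    using L L' by (simp_all add: is_covariance_log_def)
  fix p assume "p \<in> Delta2 P \<alpha>"
  then obtain x u v where p: "p = (x, ray u, ray v)" and x: "x \<in> interior P" and uv: "u \<in> D x" "v \<in> D x"
    by (auto simp: Delta2_def)
  obtain s where s: "left_coherent P \<alpha> s" "ray (s x) = ray u" using left_coherent_through[OF x uv(1)] .
  obtain t where t: "left_coherent P \<alpha> t" "ray (t x) = ray v" using left_coherent_through[OF x uv(2)] .
  define f where "f y = L (y, ray (s y), ray (t y))" for y
  define f' where "f' y = L' (y, ray (s y), ray (t y))" for y
  have exp_eq: "exp (f y) = exp (f' y)" if "y \<in> interior P" for y
    using that s t left_coherent_D interior_subset_P
    by (simp add: f_def f'_def is_covariance_logD(3)[OF L] is_covariance_logD(3)[OF L'])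
  have "((\<lambda>y. f y - f' y) \<longlongrightarrow> 0 - 0) (at 0 within interior P)"
    unfolding f_def f'_def using s t by (intro tendsto_diff is_covariance_logD(2)[OF L] is_covariance_logD(2)[OF L'])
  then have "\<forall>\<^sub>F y in at 0 within interior P. norm (f y - f' y) < 1"
    using tendstoD[of "\<lambda>y. f y - f' y" 0 _ 1] by simp
  moreover have "\<forall>\<^sub>F y in at 0 within interior P. y \<in> interior P"
    by (simp add: eventually_at_filter)
  ultimately have "\<forall>\<^sub>F y in at 0 within interior P. y \<in> interior P \<and> f y = f' y"
    by eventually_elim (use exp_eq complex_exp_eq_near in blast)
  then obtain a where a: "a \<in> interior P" "f a = f' a"
    using eventually_happens'[OF at_zero_within_interior_nontrivial] by blast
  have "f x = f' x"
  proof (rule continuous_logs_agree[where f = f and g = f' and S = "interior P" and a = a])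
    show "connected (interior P)" by (intro convex_connected convex_interior convex_P)
    show "continuous_on (interior P) f" "continuous_on (interior P) f'"
      unfolding f_def f'_def using s t is_covariance_logD(1)[OF L] is_covariance_logD(1)[OF L'] by blast+
  qed (use exp_eq a x in auto)
  then show "L p = L' p" by (simp add: f_def f'_def p s t)
qed

text \<open>The value at \<open>(x, u, v)\<close> is that of the logarithm along any pair of sections through the two rays.\<close>

lemma covariance_log_exists:
  assumes e: "unit_left_coherent P \<alpha> e"
  shows "\<exists>L. is_covariance_log P \<alpha> e L"
proof -
  note ce = unit_left_coherent_left_coherent[OF e]
  define G where "G u v = (SOME g. is_section_log e u v g)" for u v
  have G: "is_section_log e u v (G u v)" if "left_coherent P \<alpha> u" "left_coherent P \<alpha> v" for u v
    unfolding G_def using section_log_exists[OF e that] by (rule someI_ex)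
  define S where "S x r = (SOME s. left_coherent P \<alpha> s \<and> ray (s x) = r)" for x r
  have S: "left_coherent P \<alpha> (S x (ray (u x)))" "ray (S x (ray (u x)) x) = ray (u x)"
    if "left_coherent P \<alpha> u" for u x
    using someI[of "\<lambda>s. left_coherent P \<alpha> s \<and> ray (s x) = ray (u x)" u] that by (simp_all add: S_def)
  define L where "L = (\<lambda>(x, r, r'). G (S x r) (S x r') x)"
  have L: "L (x, ray (u x), ray (v x)) = G u v x"
    if "left_coherent P \<alpha> u" "left_coherent P \<alpha> v" "x \<in> P" for u v x
    unfolding L_def prod.case
    by (rule section_log_depends_on_rays[OF e S(1)[OF that(1)] S(1)[OF that(2)] that(1,2)
          G[OF S(1)[OF that(1)] S(1)[OF that(2)]] G[OF that(1,2)] that(3) S(2)[OF that(1)] S(2)[OF that(2)]])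
  have "is_covariance_log P \<alpha> e (restrict L (Delta2 P \<alpha>))"
  proof (rule is_covariance_logI[OF _ _ _ ce])
    fix u v assume uv: "left_coherent P \<alpha> u" "left_coherent P \<alpha> v"
    note g = G[OF uv, unfolded is_section_log_def]
    show "continuous_on (interior P) (\<lambda>x. L (x, ray (u x), ray (v x)))"
      using continuous_on_subset[OF conjunct1[OF g] interior_subset]
      by (rule continuous_on_eq) (simp add: L uv interior_subset_P)
    have "(G u v \<longlongrightarrow> 0) (at 0 within P)"
      using bspec[OF conjunct1[OF g, unfolded continuous_on_def] zero_in_P] g by simp
    then have "(G u v \<longlongrightarrow> 0) (at 0 within interior P)"
      by (rule tendsto_within_subset[OF _ interior_subset])
    then show "((\<lambda>x. L (x, ray (u x), ray (v x))) \<longlongrightarrow> 0) (at 0 within interior P)"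
      by (rule Lim_transform_eventually) (simp add: eventually_at_filter L uv interior_subset_P)
    show "exp (L (x, ray (u x), ray (v x))) = covariance (e x) (u x) (v x)" if "x \<in> interior P" for x
      using that g by (simp add: L uv interior_subset_P)
  qed
  then show ?thesis by (rule exI[of _ "restrict L (Delta2 P \<alpha>)"])
qed

text \<open>\<open>(x, u, v) \<mapsto> cnj (L (x, v, u))\<close> has the defining properties of \<open>L\<close>, so uniqueness applies.\<close>

lemma covariance_log_hermitian:
  assumes e: "left_coherent P \<alpha> e" and L: "is_covariance_log P \<alpha> e L"
    and x: "x \<in> interior P" and u: "u \<in> D x" and v: "v \<in> D x"
  shows "L (x, ray v, ray u) = cnj (L (x, ray u, ray v))"
proof -
  define L' where "L' = (\<lambda>(x, r, r'). cnj (L (x, r', r)))"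
  have "is_covariance_log P \<alpha> e (restrict L' (Delta2 P \<alpha>))"
  proof (rule is_covariance_logI[OF _ _ _ e])
    fix u v assume uv: "left_coherent P \<alpha> u" "left_coherent P \<alpha> v"
    show "continuous_on (interior P) (\<lambda>x. L' (x, ray (u x), ray (v x)))"
      unfolding L'_def prod.case by (rule continuous_on_cnj[OF is_covariance_logD(1)[OF L uv(2,1)]])
    show "((\<lambda>x. L' (x, ray (u x), ray (v x))) \<longlongrightarrow> 0) (at 0 within interior P)"
      using tendsto_cnj[OF is_covariance_logD(2)[OF L uv(2,1)]] by (simp add: L'_def)
    fix x assume x: "x \<in> interior P"
    note xP = interior_subset_P[OF x]
    note E = left_coherent_E[OF e xP] left_coherent_E[OF uv(1) xP] left_coherent_E[OF uv(2) xP]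
    have "exp (L' (x, ray (u x), ray (v x))) = cnj (covariance (e x) (v x) (u x))"
      unfolding L'_def prod.case exp_cnj[symmetric]
        is_covariance_logD(3)[OF L x left_coherent_D[OF uv(2) xP] left_coherent_D[OF uv(1) xP]] ..
    also have "\<dots> = covariance (e x) (u x) (v x)"
      using ps_inner_commute[OF xP E(2,3)] ps_inner_commute[OF xP E(2,1)] ps_inner_commute[OF xP E(1,3)]
      by (simp add: covariance_def mult.commute)
    finally show "exp (L' (x, ray (u x), ray (v x))) = covariance (e x) (u x) (v x)" .
  qed
  from covariance_log_unique[OF L this] have "L (x, ray v, ray u) = restrict L' (Delta2 P \<alpha>) (x, ray v, ray u)"
    by simp
  also have "\<dots> = cnj (L (x, ray u, ray v))"
    using x u v by (auto simp: L'_def Delta2_def)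
  finally show ?thesis .
qed

text \<open>In the exponential of the right-hand side all inner products with \<open>e\<close> cancel, leaving
  \<open>\<langle>u|v\<rangle>\<langle>f|f\<rangle> / (\<langle>u|f\<rangle>\<langle>f|v\<rangle>)\<close>. It therefore has the defining properties of the logarithm based at \<open>f\<close>.\<close>

lemma covariance_log_change_base:
  assumes e: "unit_left_coherent P \<alpha> e" and f: "unit_left_coherent P \<alpha> f"
    and Le: "is_covariance_log P \<alpha> e Le" and Lf: "is_covariance_log P \<alpha> f Lf"
    and x: "x \<in> interior P" and u: "u \<in> D x" and v: "v \<in> D x"
  shows "Lf (x, ray u, ray v) = Le (x, ray u, ray v) - Le (x, ray u, ray (f x))
    - Le (x, ray (f x), ray v) + Le (x, ray (f x), ray (f x))"
proof -
  note ce = unit_left_coherent_left_coherent[OF e] and cf = unit_left_coherent_left_coherent[OF f]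
  define M where "M = (\<lambda>(x, r, r'). Le (x, r, r') - Le (x, r, ray (f x))
    - Le (x, ray (f x), r') + Le (x, ray (f x), ray (f x)))"
  have "is_covariance_log P \<alpha> f (restrict M (Delta2 P \<alpha>))"
  proof (rule is_covariance_logI[OF _ _ _ cf])
    fix u v assume u: "left_coherent P \<alpha> u" and v: "left_coherent P \<alpha> v"
    show "continuous_on (interior P) (\<lambda>x. M (x, ray (u x), ray (v x)))"
      unfolding M_def prod.case by (intro continuous_intros is_covariance_logD(1)[OF Le] u v cf)
    have "((\<lambda>x. M (x, ray (u x), ray (v x))) \<longlongrightarrow> 0 - 0 - 0 + 0) (at 0 within interior P)"
      unfolding M_def prod.case by (intro tendsto_intros is_covariance_logD(2)[OF Le] u v cf)
    then show "((\<lambda>x. M (x, ray (u x), ray (v x))) \<longlongrightarrow> 0) (at 0 within interior P)" by simp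
    fix x assume x: "x \<in> interior P"
    note xP = interior_subset_P[OF x]
    note D = left_coherent_D[OF u xP] left_coherent_D[OF v xP] left_coherent_D[OF cf xP]
    note nz = ps_inner_left_coherent_nonzero[OF _ _ xP]
    show "exp (M (x, ray (u x), ray (v x))) = covariance (f x) (u x) (v x)"
      using nz[OF u ce] nz[OF ce v] nz[OF u cf] nz[OF cf v] nz[OF ce cf] nz[OF cf ce] ps_inner_unit[OF f xP]
      by (simp add: M_def exp_add exp_diff is_covariance_logD(3)[OF Le x] D covariance_def field_simps)
  qed
  from covariance_log_unique[OF Lf this] have "Lf (x, ray u, ray v) = restrict M (Delta2 P \<alpha>) (x, ray u, ray v)"
    by simp
  then show ?thesis
    using x u v by (auto simp: M_def Delta2_def)
qed

text \<open>The base change formula has the required form with \<open>\<phi>(x, u) = L\<^sup>e(x, f, f) / 2 - L\<^sup>e(x, u, f)\<close>: by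
  hermitian symmetry \<open>L\<^sup>e(x, f, v)\<close> is conjugate to \<open>L\<^sup>e(x, v, f)\<close>, and \<open>L\<^sup>e(x, f, f)\<close> is real.\<close>

lemma covariance_log_coboundary:
  assumes e: "unit_left_coherent P \<alpha> e" and f: "unit_left_coherent P \<alpha> f"
    and Le: "is_covariance_log P \<alpha> e Le" and Lf: "is_covariance_log P \<alpha> f Lf"
  shows "\<exists>\<phi>. \<phi> \<in> Delta P \<alpha> \<rightarrow>\<^sub>E UNIV \<and> Delta_continuous P \<alpha> \<phi> \<and> Delta_vanishes_at_origin P \<alpha> \<phi> \<and>
    (\<forall>x\<in>interior P. \<forall>u\<in>D x. \<forall>v\<in>D x.
      Lf (x, ray u, ray v) = Le (x, ray u, ray v) + \<phi> (x, ray u) + cnj (\<phi> (x, ray v)))"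
proof -
  note ce = unit_left_coherent_left_coherent[OF e] and cf = unit_left_coherent_left_coherent[OF f]
  define \<psi> where "\<psi> = (\<lambda>(x, r). Le (x, ray (f x), ray (f x)) / 2 - Le (x, r, ray (f x)))"
  define \<phi> where "\<phi> = restrict \<psi> (Delta P \<alpha>)"
  have \<phi>: "\<phi> (x, ray u) = Le (x, ray (f x), ray (f x)) / 2 - Le (x, ray u, ray (f x))"
    if "x \<in> interior P" "u \<in> D x" for x u
    using that by (auto simp: \<phi>_def \<psi>_def Delta_def)
  have \<phi>_coh: "\<phi> (x, ray (u x)) = Le (x, ray (f x), ray (f x)) / 2 - Le (x, ray (u x), ray (f x))"
    if "left_coherent P \<alpha> u" "x \<in> interior P" for x u
    using that left_coherent_D interior_subset_P by (intro \<phi>) auto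
  have "\<phi> \<in> Delta P \<alpha> \<rightarrow>\<^sub>E UNIV" by (simp add: \<phi>_def)
  moreover have "Delta_continuous P \<alpha> \<phi>"
    unfolding Delta_continuous_def
  proof (intro allI impI)
    fix u assume u: "left_coherent P \<alpha> u"
    have "continuous_on (interior P) (\<lambda>x. Le (x, ray (f x), ray (f x)) / 2 - Le (x, ray (u x), ray (f x)))"
      by (intro continuous_intros is_covariance_logD(1)[OF Le] cf u) simp
    then show "continuous_on (interior P) (\<lambda>x. \<phi> (x, ray (u x)))"
      by (rule continuous_on_eq) (simp add: \<phi>_coh[OF u])
  qed
  moreover have "Delta_vanishes_at_origin P \<alpha> \<phi>"
    unfolding Delta_vanishes_at_origin_def
  proof (intro allI impI)
    fix u assume u: "left_coherent P \<alpha> u"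
    have "((\<lambda>x. Le (x, ray (f x), ray (f x)) / 2 - Le (x, ray (u x), ray (f x))) \<longlongrightarrow> 0 / 2 - 0) (at 0 within interior P)"
      by (intro tendsto_intros is_covariance_logD(2)[OF Le] cf u) simp
    then have "((\<lambda>x. Le (x, ray (f x), ray (f x)) / 2 - Le (x, ray (u x), ray (f x))) \<longlongrightarrow> 0) (at 0 within interior P)"
      by simp
    then show "((\<lambda>x. \<phi> (x, ray (u x))) \<longlongrightarrow> 0) (at 0 within interior P)"
      by (rule Lim_transform_eventually) (simp add: eventually_at_filter \<phi>_coh[OF u])
  qed
  moreover have "Lf (x, ray u, ray v) = Le (x, ray u, ray v) + \<phi> (x, ray u) + cnj (\<phi> (x, ray v))"
    if x: "x \<in> interior P" and u: "u \<in> D x" and v: "v \<in> D x" for x u v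
  proof -
    have fx: "f x \<in> D x" using left_coherent_D[OF cf interior_subset_P[OF x]] .
    have "cnj (\<phi> (x, ray v)) = Le (x, ray (f x), ray (f x)) / 2 - Le (x, ray (f x), ray v)"
      using covariance_log_hermitian[OF ce Le x fx fx] covariance_log_hermitian[OF ce Le x v fx]
      by (simp add: \<phi>[OF x v])
    then show ?thesis
      using covariance_log_change_base[OF e f Le Lf x u v] by (simp add: \<phi>[OF x u])
  qed
  ultimately show ?thesis by blast
qed

end

theorem theorem3p11:
  fixes P :: "(real^'d) set"
    and \<alpha> :: "real^'d \<Rightarrow> ('h::complex_hilbert \<Rightarrow>\<^sub>L 'h) \<Rightarrow> ('h \<Rightarrow>\<^sub>L 'h)"
    and e :: "real^'d \<Rightarrow> ('h \<Rightarrow>\<^sub>L 'h)"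
  assumes "\<not> (\<exists>B :: 'h set. finite B \<and> cspan B = UNIV)"
    and "separable_space (euclidean :: 'h topology)"
    and "closed_pointed_generating_cone P"
    and "decomposable_E0_semigroup P \<alpha>"
    and "unit_left_coherent P \<alpha> e"
  shows "(\<exists>!L. is_covariance_log P \<alpha> e L) \<and>
    (\<forall>f Le Lf. unit_left_coherent P \<alpha> f \<longrightarrow>
       is_covariance_log P \<alpha> e Le \<longrightarrow> is_covariance_log P \<alpha> f Lf \<longrightarrow>
       (\<exists>\<phi>. \<phi> \<in> Delta P \<alpha> \<rightarrow>\<^sub>E UNIV \<and> Delta_continuous P \<alpha> \<phi> \<and> Delta_vanishes_at_origin P \<alpha> \<phi> \<and>
          (\<forall>x\<in>interior P. \<forall>u\<in>decomposables P \<alpha> x. \<forall>v\<in>decomposables P \<alpha> x.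
             Lf (x, ray u, ray v) = Le (x, ray u, ray v) + \<phi> (x, ray u) + cnj (\<phi> (x, ray v)))))"
proof -
  have "\<exists>\<zeta>::'h. \<zeta> \<noteq> 0"
  proof (rule ccontr)
    assume "\<nexists>\<zeta>::'h. \<zeta> \<noteq> 0"
    then have "UNIV = {0::'h}" by auto
    then have "cspan ({}::'h set) = UNIV" by (simp add: complex_vector.span_empty)
    then show False using assms(1) by blast
  qed
  then interpret decomposable_semigroup P \<alpha>
    using assms(3,4) by unfold_locales
  show ?thesis
    using covariance_log_exists[OF assms(5)] covariance_log_unique
      covariance_log_coboundary[OF assms(5)] by blast
qed

end
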